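(* The following decision problem is undecidable: given a finite set $G$ of matrices in $\mathbb{Z}^{4\times4}$, generating the multiplicative semigroup $S$, and a matrix $M\in S$, decide whether $M$ has more than one factorization over $G$.
   Context: For a finite set $G$ of matrices, $S=\langle G\rangle$ denotes the semigroup of all finite nonempty products of elements of $G$. A factorization of $M\in S$ over $G$ is a finite nonempty sequence $(A_1,\dots,A_t)$ of elements of $G$ with $A_1A_2\cdots A_t=M$; two factorizations are different if they are different sequences. *)

theory Defs
  imports "HOL-Analysis.Cartesian_Space" "HOL-Library.Nat_Bijection"
begin

section \<open>Partial recursive functions\<close>

datatype recf =
    Zero
  | Succ
  | Proj nat
  | Comp recf "recf list"
  | PrimRec recf recf
  | Minim recf

text \<open>\<open>rec_eval f xs y\<close>: the partial recursive function described by \<open>f\<close> is defined at \<open>xs\<close>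
  with value \<open>y\<close>. Absence of any \<open>y\<close> means divergence (or an arity mismatch).\<close>

inductive rec_eval :: "recf \<Rightarrow> nat list \<Rightarrow> nat \<Rightarrow> bool" where
  Zero: "rec_eval Zero xs 0"
| Succ: "rec_eval Succ [x] (Suc x)"
| Proj: "i < length xs \<Longrightarrow> rec_eval (Proj i) xs (xs ! i)"
| Comp: "list_all2 (\<lambda>g y. rec_eval g xs y) gs ys \<Longrightarrow> rec_eval f ys z \<Longrightarrow> rec_eval (Comp f gs) xs z"
| PrimRec_0: "rec_eval f xs y \<Longrightarrow> rec_eval (PrimRec f g) (0 # xs) y"
| PrimRec_Suc: "rec_eval (PrimRec f g) (n # xs) y \<Longrightarrow> rec_eval g (n # y # xs) z \<Longrightarrow>
    rec_eval (PrimRec f g) (Suc n # xs) z"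
| Minim: "rec_eval f (n # xs) 0 \<Longrightarrow> (\<And>m. m < n \<Longrightarrow> \<exists>y. rec_eval f (m # xs) (Suc y)) \<Longrightarrow>
    rec_eval (Minim f) xs n"

inductive_cases rec_eval_ZeroE: "rec_eval Zero xs y"
inductive_cases rec_eval_SuccE: "rec_eval Succ xs y"
inductive_cases rec_eval_ProjE: "rec_eval (Proj i) xs y"
inductive_cases rec_eval_CompE: "rec_eval (Comp f gs) xs y"
inductive_cases rec_eval_PrimRec_0E: "rec_eval (PrimRec f g) (0 # xs) y"
inductive_cases rec_eval_PrimRec_SucE: "rec_eval (PrimRec f g) (Suc n # xs) y"
inductive_cases rec_eval_MinimE: "rec_eval (Minim f) xs y"

lemma rec_eval_deterministic:
  assumes "rec_eval f xs y" and "rec_eval f xs z"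
  shows "y = z"
  using assms
proof (induction arbitrary: z rule: rec_eval.induct)
  case (Comp xs gs ys f z')
  from Comp.prems obtain ys' where ys': "list_all2 (\<lambda>g y. rec_eval g xs y) gs ys'" "rec_eval f ys' z"
    by (rule rec_eval_CompE)
  have "ys = ys'"
    using Comp.IH(1) ys'(1) by (auto simp: list_all2_conv_all_nth intro!: nth_equalityI)
  with Comp.IH(2) ys'(2) show ?case by blast
next
  case (PrimRec_Suc f g n xs y z')
  from PrimRec_Suc.prems obtain y' where
    "rec_eval (PrimRec f g) (n # xs) y'" "rec_eval g (n # y' # xs) z"
    by (rule rec_eval_PrimRec_SucE)
  with PrimRec_Suc.IH show ?case by blast
next
  case (Minim f n xs)
  from Minim.prems have z: "rec_eval f (z # xs) 0" "\<forall>m<z. \<exists>y. rec_eval f (m # xs) (Suc y)"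
    by (blast elim: rec_eval_MinimE)+
  have "\<not> z < n" using Minim.IH(2) z(1) by fastforce
  moreover have "\<not> n < z" using Minim.IH(1) z(2) by fastforce
  ultimately show ?case by simp
qed (blast elim: rec_eval_ZeroE rec_eval_SuccE rec_eval_ProjE rec_eval_PrimRec_0E)+

text \<open>A problem with instance set \<open>I\<close>, given as input through the coding \<open>enc\<close>. The algorithm
  must halt with the right answer on every instance in \<open>I\<close>; its behaviour on numbers that are
  not codes of elements of \<open>I\<close> is unconstrained.\<close>

definition decidable_on :: "('a \<Rightarrow> nat) \<Rightarrow> 'a set \<Rightarrow> ('a \<Rightarrow> bool) \<Rightarrow> bool" where
  "decidable_on enc I P \<longleftrightarrow> (\<exists>f. \<forall>x\<in>I. rec_eval f [enc x] (if P x then 1 else 0))"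

section \<open>Matrix semigroups and factorizations\<close>

text \<open>The type class multiplication on vectors is componentwise, hence the explicit
  use of the matrix product.\<close>

definition mat_prod :: "('a::semiring_1 ^ 'n ^ 'n) list \<Rightarrow> 'a ^ 'n ^ 'n" where
  "mat_prod As = foldr (**) As (mat 1)"

definition generated_semigroup :: "('a::semiring_1 ^ 'n ^ 'n) set \<Rightarrow> ('a ^ 'n ^ 'n) set" where
  "generated_semigroup G = {mat_prod As | As. As \<noteq> [] \<and> set As \<subseteq> G}"

definition factorization ::
  "('a::semiring_1 ^ 'n ^ 'n) set \<Rightarrow> 'a ^ 'n ^ 'n \<Rightarrow> ('a ^ 'n ^ 'n) list \<Rightarrow> bool" where
  "factorization G M As \<longleftrightarrow> As \<noteq> [] \<and> set As \<subseteq> G \<and> mat_prod As = M"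

definition more_than_one_factorization ::
  "('a::semiring_1 ^ 'n ^ 'n) set \<Rightarrow> 'a ^ 'n ^ 'n \<Rightarrow> bool" where
  "more_than_one_factorization G M \<longleftrightarrow>
     (\<exists>As Bs. factorization G M As \<and> factorization G M Bs \<and> As \<noteq> Bs)"

section \<open>Coding of instances\<close>

text \<open>The sixteen entries in row-major order; the index type \<open>4\<close> has the elements
  \<open>0, 1, 2, 3\<close>.\<close>

definition mat_code :: "int ^ 4 ^ 4 \<Rightarrow> nat" where
  "mat_code A = list_encode [int_encode (A $ i $ j). i \<leftarrow> [0, 1, 2, 3], j \<leftarrow> [0, 1, 2, 3]]"

definition instance_code :: "(int ^ 4 ^ 4) set \<times> (int ^ 4 ^ 4) \<Rightarrow> nat" where
  "instance_code = (\<lambda>(G, M). prod_encode (set_encode (mat_code ` G), mat_code M))"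

lemma UNIV_4_from_0: "(UNIV :: 4 set) = {0, 1, 2, 3}"
proof -
  have "i \<in> {0, 1, 2, 3}" for i :: 4
    using exhaust_4[of i] by auto
  then show ?thesis by blast
qed

lemma inj_mat_code: "inj mat_code"
proof (rule injI)
  fix A B :: "int ^ 4 ^ 4"
  assume "mat_code A = mat_code B"
  then have "\<forall>i\<in>{0, 1, 2, 3}. \<forall>j\<in>{0, 1, 2, 3}. A $ i $ j = B $ i $ j"
    by (simp add: mat_code_def list_encode_eq int_encode_eq)
  then show "A = B"
    unfolding UNIV_4_from_0[symmetric] by (simp add: vec_eq_iff)
qed

lemma inj_on_instance_code: "inj_on instance_code {(G, M). finite G}"
proof (rule inj_onI, clarify)
  fix G H :: "(int ^ 4 ^ 4) set" and M N :: "int ^ 4 ^ 4"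
  assume "finite G" "finite H" and "instance_code (G, M) = instance_code (H, N)"
  then have "mat_code ` G = mat_code ` H" "mat_code M = mat_code N"
    by (auto simp: instance_code_def set_encode_eq)
  then show "G = H \<and> M = N"
    using inj_mat_code by (simp add: inj_image_eq_iff inj_eq)
qed

end

theory Submission
  imports Defs "HOL-Computational_Algebra.Primes"
begin

text \<open>Suppose that \<open>f\<close> decides the problem. For a finite set \<open>X\<close> of pairs of words and a word \<open>w\<close>, let
  \<open>G\<close> consist of the matrices encoding the pairs, together with one rank-one matrix \<open>B = a b\<^sub>w\<close>. For a
  product \<open>P\<close> of pair matrices, \<open>B P B = (b\<^sub>w P a) B\<close>, and \<open>b\<^sub>w P a\<close> has the form \<open>3 (x - y) + 1\<close>, where
  \<open>x\<close> and \<open>y\<close> are the base-5 values of \<open>w v\<^sub>1 \<dots> v\<^sub>m\<close> and \<open>u\<^sub>1 \<dots> u\<^sub>m\<close>. This is a unit only if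
  the two words agree, so \<open>B\<close> has a second factorization iff the Post-type equation
  \<open>w v\<^sub>1 \<dots> v\<^sub>m = u\<^sub>1 \<dots> u\<^sub>m\<close> has a solution.

  Halting of a recursive function \<open>D\<close> on \<open>n\<close> reduces to such an equation, via while programs, Goedel
  numbers and rewriting of numbers \<open>d m + r \<rightarrow> c m + e\<close>, in such a way that \<open>X\<close> depends only on \<open>D\<close> and
  \<open>w\<close> only on \<open>n\<close>. The set code of \<open>G\<close> is therefore the set code of the pair matrices of \<open>D\<close> plus a
  power of two computable from \<open>n\<close>. Let \<open>D\<close> on input \<open>n\<close> apply \<open>f\<close> to the instance with set code
  \<open>n + 2\<^sup>k\<close>, where \<open>k\<close> is the code of \<open>B\<close> for \<open>n\<close>, and halt iff the answer is 0. Taking for \<open>n\<close> the set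
  code of the pair matrices of \<open>D\<close> itself gives a contradiction.\<close>

section \<open>Recursive functions\<close>

definition recursive1 :: "(nat \<Rightarrow> nat) \<Rightarrow> bool" where
  "recursive1 h \<longleftrightarrow> (\<exists>f. \<forall>x. rec_eval f [x] (h x))"

definition recursive2 :: "(nat \<Rightarrow> nat \<Rightarrow> nat) \<Rightarrow> bool" where
  "recursive2 h \<longleftrightarrow> (\<exists>f. \<forall>x y. rec_eval f [x, y] (h x y))"

lemma rec_eval_Proj0: "rec_eval (Proj 0) (x # xs) x"
  using rec_eval.Proj[of 0 "x # xs"] by simp

lemma rec_eval_Proj1: "rec_eval (Proj (Suc 0)) (x # y # xs) y"
  using rec_eval.Proj[of "Suc 0" "x # y # xs"] by simp

lemma rec_eval_Proj2: "rec_eval (Proj (Suc (Suc 0))) (x # y # z # xs) z"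
  using rec_eval.Proj[of "Suc (Suc 0)" "x # y # z # xs"] by simp

lemma rec_eval_Comp1: "rec_eval g xs y \<Longrightarrow> rec_eval f [y] z \<Longrightarrow> rec_eval (Comp f [g]) xs z"
  by (rule rec_eval.Comp[where ys = "[y]"]) auto

lemma rec_eval_Comp2:
  "rec_eval g xs y \<Longrightarrow> rec_eval g' xs y' \<Longrightarrow> rec_eval f [y, y'] z \<Longrightarrow> rec_eval (Comp f [g, g']) xs z"
  by (rule rec_eval.Comp[where ys = "[y, y']"]) auto

lemma recursive1_id: "recursive1 (\<lambda>x. x)"
  unfolding recursive1_def using rec_eval_Proj0 by blast

lemma recursive1_compose: "recursive1 g \<Longrightarrow> recursive1 h \<Longrightarrow> recursive1 (\<lambda>x. g (h x))"
  unfolding recursive1_def by (meson rec_eval_Comp1)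

lemma recursive2_compose:
  "recursive2 g \<Longrightarrow> recursive1 h \<Longrightarrow> recursive1 k \<Longrightarrow> recursive1 (\<lambda>x. g (h x) (k x))"
  unfolding recursive1_def recursive2_def by (meson rec_eval_Comp2)

lemma recursive1_Suc: "recursive1 Suc"
  unfolding recursive1_def using rec_eval.Succ by blast

lemma recursive1_const: "recursive1 (\<lambda>x. c)"
proof (induction c)
  case 0
  show ?case unfolding recursive1_def using rec_eval.Zero by blast
next
  case (Suc c)
  show ?case using recursive1_compose[OF recursive1_Suc Suc] .
qed

lemma recursive2_PrimRec:
  assumes "\<And>x. rec_eval f [x] (h 0 x)" "\<And>n x. rec_eval g [n, h n x, x] (h (Suc n) x)"
  shows "recursive2 h"
proof -
  have "rec_eval (PrimRec f g) [n, x] (h n x)" for n x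
    by (induction n) (use assms in \<open>auto intro: rec_eval.intros\<close>)
  then show ?thesis unfolding recursive2_def by blast
qed

lemma recursive1_PrimRec:
  assumes "rec_eval f [] (h 0)" "\<And>n. rec_eval g [n, h n] (h (Suc n))"
  shows "recursive1 h"
proof -
  have "rec_eval (PrimRec f g) [n] (h n)" for n
    by (induction n) (use assms in \<open>auto intro: rec_eval.intros\<close>)
  then show ?thesis unfolding recursive1_def by blast
qed

lemma recursive2_add: "recursive2 (+)"
  by (rule recursive2_PrimRec[where f = "Proj 0" and g = "Comp Succ [Proj 1]"])
    (auto intro: rec_eval_Proj0 rec_eval_Proj1 rec_eval_Comp1 rec_eval.Succ)

lemma recursive2_mult: "recursive2 (*)"
proof -
  obtain p where p: "\<And>x y. rec_eval p [x, y] (x + y)"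
    using recursive2_add unfolding recursive2_def by blast
  show ?thesis
    by (rule recursive2_PrimRec[where f = Zero and g = "Comp p [Proj 2, Proj 1]"])
      (auto simp: numeral_2_eq_2 intro!: rec_eval.Zero rec_eval_Proj1 rec_eval_Proj2 rec_eval_Comp2 p)
qed

text \<open>The exponent comes first because primitive recursion runs over the first
  argument.\<close>

lemma recursive2_power: "recursive2 (\<lambda>n x. x ^ n)"
proof -
  obtain p where p: "\<And>x y. rec_eval p [x, y] (x * y)"
    using recursive2_mult unfolding recursive2_def by blast
  show ?thesis
  proof (rule recursive2_PrimRec[where f = "Comp Succ [Zero]" and g = "Comp p [Proj 2, Proj 1]"])
    show "rec_eval (Comp Succ [Zero]) [x] (x ^ 0)" for x
      using rec_eval_Comp1[OF rec_eval.Zero rec_eval.Succ] by simp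
    show "rec_eval (Comp p [Proj 2, Proj 1]) [n, x ^ n, x] (x ^ Suc n)" for n x
      using rec_eval_Comp2[OF rec_eval_Proj2 rec_eval_Proj1 p] by (simp add: numeral_2_eq_2)
  qed
qed

lemma recursive1_pred: "recursive1 (\<lambda>n. n - 1)"
  by (rule recursive1_PrimRec[where f = Zero and g = "Proj 0"])
    (auto intro: rec_eval.Zero rec_eval_Proj0)

lemma recursive1_triangle: "recursive1 triangle"
proof -
  obtain p where p: "\<And>x y. rec_eval p [x, y] (x + y)"
    using recursive2_add unfolding recursive2_def by blast
  show ?thesis
  proof (rule recursive1_PrimRec[where f = Zero and g = "Comp p [Proj 1, Comp Succ [Proj 0]]"])
    show "rec_eval Zero [] (triangle 0)" by (auto intro: rec_eval.Zero)
    show "rec_eval (Comp p [Proj 1, Comp Succ [Proj 0]]) [n, triangle n] (triangle (Suc n))" for n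
      unfolding triangle_Suc One_nat_def
      by (rule rec_eval_Comp2[OF rec_eval_Proj1 rec_eval_Comp1[OF rec_eval_Proj0 rec_eval.Succ] p])
  qed
qed

lemmas recursive1_arith =
  recursive1_compose[OF recursive1_pred]
  recursive1_compose[OF recursive1_triangle]
  recursive1_compose[OF recursive1_Suc]
  recursive2_compose[OF recursive2_add]
  recursive2_compose[OF recursive2_mult]
  recursive2_compose[OF recursive2_power]

lemma recursive1_prod_encode:
  "recursive1 h \<Longrightarrow> recursive1 k \<Longrightarrow> recursive1 (\<lambda>x. prod_encode (h x, k x))"
  unfolding prod_encode_def by (auto intro!: recursive1_arith)

lemma recursive1_list_encode:
  "\<forall>h \<in> set hs. recursive1 h \<Longrightarrow> recursive1 (\<lambda>x. list_encode (map (\<lambda>h. h x) hs))"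
  by (induction hs)
    (auto intro!: recursive1_const recursive1_prod_encode recursive1_compose[OF recursive1_Suc])

section \<open>While programs\<close>

datatype com = Skip | Inc nat | Dec nat | Seq com com | While nat com

type_synonym store = "nat \<Rightarrow> nat"

primrec sem :: "com \<Rightarrow> (store \<times> store) set" where
  "sem Skip = Id"
| "sem (Inc r) = {(s, t). t = s(r := Suc (s r))}"
| "sem (Dec r) = {(s, t). s r \<noteq> 0 \<and> t = s(r := s r - 1)}"
| "sem (Seq c d) = sem c O sem d"
| "sem (While r c) = {(s, t). (s, t) \<in> ({(s, t). s r \<noteq> 0} \<inter> sem c)\<^sup>* \<and> t r = 0}"

lemma sem_Inc: "(s, t) \<in> sem (Inc r) \<longleftrightarrow> t = s(r := Suc (s r))"
  by simp

lemma sem_Seq_functional: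
  "(\<And>u. (s, u) \<in> sem c \<longleftrightarrow> u = v) \<Longrightarrow> (s, t) \<in> sem (Seq c d) \<longleftrightarrow> (v, t) \<in> sem d"
  by auto

text \<open>Meant for a first command with a partial result \<open>y\<close>: \<open>P y\<close>
  says that \<open>y\<close> is a value and \<open>F y\<close> is the store that holds it.
  Divergence is the case where no \<open>y\<close> exists.\<close>

lemma sem_Seq_partial:
  assumes "\<And>u. (s, u) \<in> sem c \<longleftrightarrow> (\<exists>y. P y \<and> u = F y)"
    and "\<And>y. P y \<Longrightarrow> (F y, t) \<in> sem d \<longleftrightarrow> Q y"
  shows "(s, t) \<in> sem (Seq c d) \<longleftrightarrow> (\<exists>y. P y \<and> Q y)"
proof -
  have "(s, t) \<in> sem (Seq c d) \<longleftrightarrow> (\<exists>u. (s, u) \<in> sem c \<and> (u, t) \<in> sem d)" by auto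
  also have "\<dots> \<longleftrightarrow> (\<exists>y. P y \<and> (F y, t) \<in> sem d)" unfolding assms(1) by blast
  also have "\<dots> \<longleftrightarrow> (\<exists>y. P y \<and> Q y)" using assms(2) by blast
  finally show ?thesis .
qed

lemma sem_While_unfold:
  "(s, t) \<in> sem (While r c) \<longleftrightarrow>
    (if s r = 0 then t = s else \<exists>u. (s, u) \<in> sem c \<and> (u, t) \<in> sem (While r c))"
  by (auto elim: converse_rtranclE intro: converse_rtrancl_into_rtrancl)

text \<open>For loops that always terminate: register \<open>r\<close> is the measure, and the final
  store \<open>F s\<close> is invariant under one pass \<open>G\<close>.\<close>

lemma sem_While_iff_function:
  assumes "\<And>s. s r = 0 \<Longrightarrow> F s = s"
    and "\<And>s u. s r \<noteq> 0 \<Longrightarrow> (s, u) \<in> sem c \<longleftrightarrow> u = G s"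
    and "\<And>s. s r \<noteq> 0 \<Longrightarrow> G s r < s r \<and> F (G s) = F s"
  shows "(s, t) \<in> sem (While r c) \<longleftrightarrow> t = F s"
proof (induction "s r" arbitrary: s rule: less_induct)
  case less
  then show ?case
    using assms by (subst sem_While_unfold) auto
qed

section \<open>Basic register programs\<close>

definition Clear :: "nat \<Rightarrow> com" where
  "Clear r = While r (Dec r)"

lemma sem_Clear: "(s, t) \<in> sem (Clear r) \<longleftrightarrow> t = s(r := 0)"
  unfolding Clear_def
  by (rule sem_While_iff_function[where F = "\<lambda>s. s(r := 0)" and G = "\<lambda>s. s(r := s r - 1)"]) auto

primrec Clears :: "nat \<Rightarrow> nat \<Rightarrow> com" where
  "Clears z 0 = Skip"
| "Clears z (Suc m) = Seq (Clear z) (Clears (Suc z) m)"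

lemma sem_Clears:
  "(s, t) \<in> sem (Clears z m) \<longleftrightarrow> t = (\<lambda>r. if z \<le> r \<and> r < z + m then 0 else s r)"
proof (induction m arbitrary: z s)
  case (Suc m)
  have "(\<lambda>r. if Suc z \<le> r \<and> r < Suc z + m then 0 else (s(z := 0)) r) =
      (\<lambda>r. if z \<le> r \<and> r < z + Suc m then 0 else s r)"
    by (auto simp: fun_eq_iff)
  then show ?case
    by (simp add: relcomp_unfold sem_Clear Suc.IH)
qed (auto simp: fun_eq_iff)

definition Move :: "nat \<Rightarrow> nat \<Rightarrow> com" where
  "Move a b = While a (Seq (Dec a) (Inc b))"

lemma sem_Move:
  assumes "a \<noteq> b"
  shows "(s, t) \<in> sem (Move a b) \<longleftrightarrow> t = s(a := 0, b := s b + s a)"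
  unfolding Move_def
proof (rule sem_While_iff_function[where F = "\<lambda>s. s(a := 0, b := s b + s a)"
      and G = "\<lambda>s. s(a := s a - 1, b := Suc (s b))"])
  show "(s, u) \<in> sem (Seq (Dec a) (Inc b)) \<longleftrightarrow> u = s(a := s a - 1, b := Suc (s b))"
    if "s a \<noteq> 0" for s u :: store
    using that assms by (simp add: relcomp_unfold)
qed (use assms in \<open>auto simp: fun_eq_iff\<close>)

text \<open>Reading \<open>a\<close> destroys it, so a second copy is built up in \<open>h\<close>
  and moved back.\<close>

definition Copy :: "nat \<Rightarrow> nat \<Rightarrow> nat \<Rightarrow> com" where
  "Copy a b h = Seq (While a (Seq (Dec a) (Seq (Inc b) (Inc h)))) (Move h a)"

lemma sem_Copy:
  assumes "a \<noteq> b" "a \<noteq> h" "b \<noteq> h" "s b = 0" "s h = 0"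
  shows "(s, t) \<in> sem (Copy a b h) \<longleftrightarrow> t = s(b := s a)"
proof -
  have 1: "(s, t) \<in> sem (While a (Seq (Dec a) (Seq (Inc b) (Inc h)))) \<longleftrightarrow>
      t = s(a := 0, b := s b + s a, h := s h + s a)" for s t
  proof (rule sem_While_iff_function[where F = "\<lambda>s. s(a := 0, b := s b + s a, h := s h + s a)"
        and G = "\<lambda>s. s(a := s a - 1, b := Suc (s b), h := Suc (s h))"])
    show "(s, u) \<in> sem (Seq (Dec a) (Seq (Inc b) (Inc h))) \<longleftrightarrow>
        u = s(a := s a - 1, b := Suc (s b), h := Suc (s h))" if "s a \<noteq> 0" for s u :: store
      using that assms(1-3) by (simp add: relcomp_unfold)
  qed (use assms(1-3) in \<open>auto simp: fun_eq_iff\<close>)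
  have 2: "(s(a := 0, b := s b + s a, h := s h + s a))
      (h := 0, a := (s(a := 0, b := s b + s a, h := s h + s a)) a +
         (s(a := 0, b := s b + s a, h := s h + s a)) h) = s(b := s a)"
    using assms by (auto simp: fun_eq_iff)
  have "(s, t) \<in> sem (Copy a b h) \<longleftrightarrow> (s(a := 0, b := s b + s a, h := s h + s a), t) \<in> sem (Move h a)"
    using 1 by (auto simp: Copy_def relcomp_unfold)
  then show ?thesis
    using sem_Move[of h a] assms(2) 2 by metis
qed

definition Diverge :: "nat \<Rightarrow> com" where
  "Diverge z = Seq (Inc z) (While z (Inc z))"

text \<open>Register \<open>z\<close> is positive when the loop starts and stays so, hence the guard
  never fails.\<close>

lemma sem_Diverge: "(s, t) \<notin> sem (Diverge z)"
proof -
  have "u z \<noteq> 0" if "(s, u) \<in> ({(s, t). s z \<noteq> 0} \<inter> sem (Inc z))\<^sup>*" "s z \<noteq> 0" for s u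
    using that by (induction rule: rtrancl_induct) auto
  then show ?thesis by (fastforce simp: Diverge_def)
qed

section \<open>Compiling partial recursive functions to while programs\<close>

primrec eval_args :: "(nat list \<Rightarrow> nat \<Rightarrow> com) list \<Rightarrow> nat list \<Rightarrow> nat \<Rightarrow> com" where
  "eval_args [] as z = Skip"
| "eval_args (c # cs) as z = Seq (c as z) (eval_args cs as (Suc z))"

text \<open>\<open>compile f as z\<close> reads the arguments from the registers \<open>as\<close>, all below \<open>z\<close>, and writes the
  result to \<open>z\<close>. The registers from \<open>z\<close> on must be zero initially, and those above \<open>z\<close> are zero
  again at the end.\<close>

primrec compile :: "recf \<Rightarrow> nat list \<Rightarrow> nat \<Rightarrow> com" where
  "compile Zero = (\<lambda>as z. Skip)"
| "compile Succ = (\<lambda>as z. if length as = 1 then Seq (Copy (hd as) z (z + 1)) (Inc z) else Diverge z)"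
| "compile (Proj i) = (\<lambda>as z. if i < length as then Copy (as ! i) z (z + 1) else Diverge z)"
| "compile (Comp f gs) = (\<lambda>as z.
     let m = length gs in
     Seq (eval_args (map compile gs) as z)
    (Seq (compile f [z..<z + m] (Suc (z + m)))
    (Seq (Clears z m)
         (Move (Suc (z + m)) z))))"
| "compile (PrimRec f g) = (\<lambda>as z. case as of [] \<Rightarrow> Diverge z | a # as \<Rightarrow>
     Seq (compile f as z)
    (Seq (Copy a (z + 2) (z + 3))
    (Seq (While (z + 2)
           (Seq (compile g ((z + 1) # z # as) (z + 3))
           (Seq (Clear z)
           (Seq (Move (z + 3) z)
           (Seq (Inc (z + 1))
                (Dec (z + 2)))))))
         (Clear (z + 1)))))"
| "compile (Minim f) = (\<lambda>as z.
     Seq (compile f (z # as) (z + 1))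
         (While (z + 1)
           (Seq (Clear (z + 1))
           (Seq (Inc z)
                (compile f (z # as) (z + 1))))))"

text \<open>The equivalence covers divergence too: without a value there is no final store. The
  equation for \<open>t\<close> also says that arguments and scratch registers are restored.\<close>

definition compiles :: "recf \<Rightarrow> bool" where
  "compiles f \<longleftrightarrow> (\<forall>as z s t. (\<forall>a \<in> set as. a < z) \<longrightarrow> (\<forall>r \<ge> z. s r = 0) \<longrightarrow>
     (s, t) \<in> sem (compile f as z) \<longleftrightarrow> (\<exists>y. rec_eval f (map s as) y \<and> t = s(z := y)))"

lemma compilesD:
  "compiles f \<Longrightarrow> \<forall>a \<in> set as. a < z \<Longrightarrow> \<forall>r \<ge> z. s r = 0 \<Longrightarrow>
     (s, t) \<in> sem (compile f as z) \<longleftrightarrow> (\<exists>y. rec_eval f (map s as) y \<and> t = s(z := y))"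
  unfolding compiles_def by blast

primrec put :: "store \<Rightarrow> nat \<Rightarrow> nat list \<Rightarrow> store" where
  "put s z [] = s"
| "put s z (y # ys) = put (s(z := y)) (Suc z) ys"

lemma put_eq: "put s z ys r = (if z \<le> r \<and> r < z + length ys then ys ! (r - z) else s r)"
proof (induction ys arbitrary: s z)
  case (Cons y ys)
  show ?case
  proof (cases "r \<le> z")
    case False
    then have "r - z = Suc (r - Suc z)" by simp
    then show ?thesis using False by (simp add: Cons.IH)
  qed (simp add: Cons.IH)
qed simp

lemma map_put: "map (put s z ys) [z..<z + length ys] = ys"
  by (rule nth_equalityI) (auto simp: put_eq)

text \<open>After one result is written to \<open>z\<close>, the precondition holds again at
  \<open>Suc z\<close>: the arguments are unchanged and all registers from there on are still
  zero.\<close>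

lemma sem_eval_args:
  assumes "\<And>g. g \<in> set gs \<Longrightarrow> compiles g"
    and "\<forall>a \<in> set as. a < z" "\<forall>r \<ge> z. s r = 0"
  shows "(s, t) \<in> sem (eval_args (map compile gs) as z) \<longleftrightarrow>
    (\<exists>ys. list_all2 (\<lambda>g y. rec_eval g (map s as) y) gs ys \<and> t = put s z ys)"
  using assms
proof (induction gs arbitrary: z s)
  case Nil
  then show ?case by auto
next
  case (Cons g gs)
  have "(s(z := y), t) \<in> sem (eval_args (map compile gs) as (Suc z)) \<longleftrightarrow>
      (\<exists>ys. list_all2 (\<lambda>g y. rec_eval g (map s as) y) gs ys \<and> t = put (s(z := y)) (Suc z) ys)" for y
  proof -
    have "map (s(z := y)) as = map s as" using Cons.prems(2) by auto
    then show ?thesis using Cons.IH[of "Suc z" "s(z := y)"] Cons.prems by fastforce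
  qed
  moreover have "(s, t) \<in> sem (compile g as z) \<longleftrightarrow> (\<exists>y. rec_eval g (map s as) y \<and> t = s(z := y))" for t
    using Cons.prems by (intro compilesD) auto
  ultimately show ?case
    by (auto simp: relcomp_unfold list_all2_Cons1) (metis put.simps(2))+
qed

lemma rec_eval_Comp_iff:
  "rec_eval (Comp f gs) xs z \<longleftrightarrow>
    (\<exists>ys. list_all2 (\<lambda>g y. rec_eval g xs y) gs ys \<and> rec_eval f ys z)"
  by (auto elim: rec_eval_CompE intro: rec_eval.Comp)

text \<open>The inner results fill \<open>z..<z + m\<close> and serve as arguments of
  \<open>f\<close>, whose value goes to \<open>Suc (z + m)\<close>. This offset keeps source and
  target of the final move distinct even for \<open>m = 0\<close>.\<close>

lemma compiles_Comp:
  assumes f: "compiles f" and gs: "\<And>g. g \<in> set gs \<Longrightarrow> compiles g"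
  shows "compiles (Comp f gs)"
  unfolding compiles_def
proof (intro allI impI)
  fix as z and s t :: store
  assume as: "\<forall>a \<in> set as. a < z" and s: "\<forall>r \<ge> z. s r = 0"
  define m where "m = length gs"
  have tail: "(put s z ys, t) \<in> sem (Seq (compile f [z..<z + m] (Suc (z + m)))
      (Seq (Clears z m) (Move (Suc (z + m)) z))) \<longleftrightarrow> (\<exists>y. rec_eval f ys y \<and> t = s(z := y))"
    if "length ys = m" for ys
  proof -
    have f': "(put s z ys, u) \<in> sem (compile f [z..<z + m] (Suc (z + m))) \<longleftrightarrow>
        (\<exists>y. rec_eval f ys y \<and> u = (put s z ys)(Suc (z + m) := y))" for u
      using compilesD[OF f, of "[z..<z + m]" "Suc (z + m)" "put s z ys" u] map_put[of s z ys] that s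
      by (simp add: put_eq)
    have "(\<lambda>r. if z \<le> r \<and> r < z + m then 0 else ((put s z ys)(Suc (z + m) := y)) r) =
        s(Suc (z + m) := y)" for y
      using that s by (auto simp: put_eq fun_eq_iff)
    then have "((put s z ys)(Suc (z + m) := y), t) \<in> sem (Seq (Clears z m) (Move (Suc (z + m)) z))
        \<longleftrightarrow> (s(Suc (z + m) := y), t) \<in> sem (Move (Suc (z + m)) z)" for y
      by (simp add: relcomp_unfold sem_Clears del: fun_upd_apply)
    moreover have "s(Suc (z + m) := 0, z := y) = s(z := y)" for y
      using s by (auto simp: fun_eq_iff)
    ultimately have "((put s z ys)(Suc (z + m) := y), t) \<in>
        sem (Seq (Clears z m) (Move (Suc (z + m)) z)) \<longleftrightarrow> t = s(z := y)" for y
      using s by (simp add: sem_Move)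
    with f' show ?thesis by (rule sem_Seq_partial)
  qed
  have "compile (Comp f gs) as z = Seq (eval_args (map compile gs) as z)
      (Seq (compile f [z..<z + m] (Suc (z + m))) (Seq (Clears z m) (Move (Suc (z + m)) z)))"
    by (simp add: m_def Let_def)
  moreover have "(s, t) \<in> sem \<dots> \<longleftrightarrow>
      (\<exists>ys. list_all2 (\<lambda>g y. rec_eval g (map s as) y) gs ys \<and>
        (\<exists>y. rec_eval f ys y \<and> t = s(z := y)))"
    using sem_eval_args[OF gs as s]
    by (rule sem_Seq_partial) (assumption, rule tail, metis list_all2_lengthD m_def)
  ultimately have "(s, t) \<in> sem (compile (Comp f gs) as z) \<longleftrightarrow>
      (\<exists>ys. list_all2 (\<lambda>g y. rec_eval g (map s as) y) gs ys \<and>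
        (\<exists>y. rec_eval f ys y \<and> t = s(z := y)))" by (simp only:)
  then show "(s, t) \<in> sem (compile (Comp f gs) as z) \<longleftrightarrow>
      (\<exists>y. rec_eval (Comp f gs) (map s as) y \<and> t = s(z := y))"
    by (auto simp: rec_eval_Comp_iff)
qed

lemma rec_eval_PrimRec_Suc_iff:
  "rec_eval (PrimRec f g) (Suc n # xs) z \<longleftrightarrow>
    (\<exists>y. rec_eval (PrimRec f g) (n # xs) y \<and> rec_eval g (n # y # xs) z)"
  by (auto elim: rec_eval_PrimRec_SucE intro: rec_eval.PrimRec_Suc)

lemma rec_eval_PrimRec_0_iff: "rec_eval (PrimRec f g) (0 # xs) z \<longleftrightarrow> rec_eval f xs z"
  by (auto elim: rec_eval_PrimRec_0E intro: rec_eval.PrimRec_0)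

lemma not_rec_eval_PrimRec_Nil: "\<not> rec_eval (PrimRec f g) [] y"
  by (auto elim: rec_eval.cases)

text \<open>The compiled program evaluates \<open>f\<close> before it looks at the recursion
  argument. That is harmless because a value at \<open>n\<close> is built from values at all smaller
  arguments.\<close>

lemma rec_eval_PrimRec_downward:
  "rec_eval (PrimRec f g) (n # xs) y \<Longrightarrow> m \<le> n \<Longrightarrow> \<exists>y. rec_eval (PrimRec f g) (m # xs) y"
proof (induction n arbitrary: y)
  case (Suc n)
  then show ?case by (metis le_Suc_eq rec_eval_PrimRec_Suc_iff)
qed auto

text \<open>Register \<open>z\<close> holds the current value, \<open>z + 1\<close> its index,
  \<open>z + 2\<close> the number of passes left and \<open>z + 3\<close> the next value.
  \<open>?S y i c\<close> is the store between passes; the invariant is that \<open>y\<close> is the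
  value at \<open>i\<close> and that \<open>i + c\<close> is the recursion argument.\<close>

lemma compiles_PrimRec:
  assumes f: "compiles f" and g: "compiles g"
  shows "compiles (PrimRec f g)"
  unfolding compiles_def
proof (intro allI impI)
  fix as z and s t :: store
  assume as: "\<forall>a \<in> set as. a < z" and s: "\<forall>r \<ge> z. s r = 0"
  show "(s, t) \<in> sem (compile (PrimRec f g) as z) \<longleftrightarrow>
      (\<exists>y. rec_eval (PrimRec f g) (map s as) y \<and> t = s(z := y))"
  proof (cases as)
    case Nil
    then show ?thesis by (simp add: sem_Diverge not_rec_eval_PrimRec_Nil)
  next
    case (Cons a bs)
    let ?xs = "map s bs"
    let ?S = "\<lambda>y i c. s(z := y, z + 1 := i, z + 2 := c)"
    define body where "body = Seq (compile g ((z + 1) # z # bs) (z + 3))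
      (Seq (Clear z) (Seq (Move (z + 3) z) (Seq (Inc (z + 1)) (Dec (z + 2)))))"
    define R where "R = {(s, t). s (z + 2) \<noteq> 0} \<inter> sem body"
    have bs: "\<forall>b \<in> set bs. b < z" and a: "a < z" using as Cons by auto
    have body: "(?S y i (Suc c), u) \<in> sem body \<longleftrightarrow>
        (\<exists>y'. rec_eval g (i # y # ?xs) y' \<and> u = ?S y' (Suc i) c)" for y i c u
    proof -
      have prems: "\<forall>a \<in> set ((z + 1) # z # bs). a < z + 3" "\<forall>r \<ge> z + 3. (?S y i (Suc c)) r = 0"
        using bs s by auto
      have "map (?S y i (Suc c)) ((z + 1) # z # bs) = i # y # ?xs"
        using bs by auto
      then have 1: "(?S y i (Suc c), u) \<in> sem (compile g ((z + 1) # z # bs) (z + 3)) \<longleftrightarrow>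
          (\<exists>y'. rec_eval g (i # y # ?xs) y' \<and> u = (?S y i (Suc c))(z + 3 := y'))" for u
        using compilesD[OF g, of "(z + 1) # z # bs" "z + 3" "?S y i (Suc c)" u, OF prems]
        by (simp only:)
      have 2: "((?S y i (Suc c))(z + 3 := y'), u) \<in>
          sem (Seq (Clear z) (Seq (Move (z + 3) z) (Seq (Inc (z + 1)) (Dec (z + 2))))) \<longleftrightarrow>
          u = ?S y' (Suc i) c" for y' u
      proof -
        have "(?S y i (Suc c))(z + 3 := y', z := 0, z + 3 := 0, z := y', z + 1 := Suc i, z + 2 := c)
          = ?S y' (Suc i) c"
          using s by (auto simp: fun_eq_iff)
        then show ?thesis
          unfolding sem_Seq_functional[OF sem_Clear] sem_Seq_functional[OF sem_Move[of "z + 3" z, simplified]]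
            sem_Seq_functional[OF sem_Inc] by (simp add: relcomp_unfold)
      qed
      show ?thesis
        unfolding body_def using 1 2 by (rule sem_Seq_partial)
    qed
    have sound: "\<exists>y i c. u = ?S y i c \<and> i + c = s a \<and> rec_eval (PrimRec f g) (i # ?xs) y"
      if "(?S y0 0 (s a), u) \<in> R\<^sup>*" "rec_eval f ?xs y0" for y0 u
      using that(1)
    proof (induction rule: rtrancl_induct)
      case base
      show ?case using that(2) by (metis add_0 rec_eval.PrimRec_0)
    next
      case (step u v)
      then obtain y i c where u: "u = ?S y i c" "i + c = s a" "rec_eval (PrimRec f g) (i # ?xs) y"
        by blast
      moreover from step.hyps(2) u(1) obtain c' where "c = Suc c'"
        unfolding R_def by (cases c) auto
      moreover from calculation step.hyps(2) obtain y' where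
        "rec_eval g (i # y # ?xs) y'" "v = ?S y' (Suc i) c'"
        unfolding R_def using body by auto
      ultimately show ?case
        by (metis add_Suc_shift rec_eval.PrimRec_Suc)
    qed
    have complete: "\<exists>y. (?S y0 0 (s a), ?S y i (s a - i)) \<in> R\<^sup>* \<and> rec_eval (PrimRec f g) (i # ?xs) y"
      if h: "rec_eval f ?xs y0" "rec_eval (PrimRec f g) (s a # ?xs) y'" "i \<le> s a" for y0 y' i
      using h(3)
    proof (induction i)
      case 0
      show ?case using h(1) rec_eval.PrimRec_0 by fastforce
    next
      case (Suc i)
      then obtain y where y: "(?S y0 0 (s a), ?S y i (s a - i)) \<in> R\<^sup>*"
        "rec_eval (PrimRec f g) (i # ?xs) y" by (meson Suc_leD)
      obtain v where v: "rec_eval (PrimRec f g) (Suc i # ?xs) v"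
        using rec_eval_PrimRec_downward h(2) Suc.prems by blast
      \<comment> \<open>Determinism identifies the intermediate value behind \<open>v\<close> with
        the \<open>y\<close> that the run has stored.\<close>
      then have "rec_eval g (i # y # ?xs) v"
        using y(2) rec_eval_deterministic by (metis rec_eval_PrimRec_Suc_iff)
      moreover have "s a - i = Suc (s a - Suc i)" using Suc.prems by simp
      ultimately have "(?S y i (s a - i), ?S v (Suc i) (s a - Suc i)) \<in> R"
        unfolding R_def using body by auto
      then show ?case using y(1) v by (meson rtrancl.rtrancl_into_rtrancl)
    qed
    have loop: "(?S y0 0 (s a), u) \<in> sem (While (z + 2) body) \<longleftrightarrow>
        (\<exists>y. rec_eval (PrimRec f g) (s a # ?xs) y \<and> u = ?S y (s a) 0)"
      if y0: "rec_eval f ?xs y0" for y0 u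
    proof
      assume "(?S y0 0 (s a), u) \<in> sem (While (z + 2) body)"
      then have "(?S y0 0 (s a), u) \<in> R\<^sup>*" "u (z + 2) = 0"
        by (auto simp: R_def)
      then show "\<exists>y. rec_eval (PrimRec f g) (s a # ?xs) y \<and> u = ?S y (s a) 0"
        using sound[OF _ y0, of u] by auto
    next
      assume "\<exists>y. rec_eval (PrimRec f g) (s a # ?xs) y \<and> u = ?S y (s a) 0"
      then show "(?S y0 0 (s a), u) \<in> sem (While (z + 2) body)"
        using complete[OF y0, of _ "s a"] rec_eval_deterministic by (fastforce simp: R_def)
    qed
    have 1: "(s, u) \<in> sem (compile f bs z) \<longleftrightarrow> (\<exists>y. rec_eval f ?xs y \<and> u = s(z := y))" for u
      using compilesD[OF f bs s] .
    have 2: "(s(z := y), u) \<in> sem (Copy a (z + 2) (z + 3)) \<longleftrightarrow> u = ?S y 0 (s a)" for y u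
    proof -
      have "(s(z := y))(z + 2 := s a) = ?S y 0 (s a)" using s by (auto simp: fun_eq_iff)
      then show ?thesis using sem_Copy[of a "z + 2" "z + 3" "s(z := y)" u] a s by simp
    qed
    have 3: "(?S y (s a) 0, u) \<in> sem (Clear (z + 1)) \<longleftrightarrow> u = s(z := y)" for y u
    proof -
      have "(?S y (s a) 0)(z + 1 := 0) = s(z := y)" using s by (auto simp: fun_eq_iff)
      then show ?thesis by (simp add: sem_Clear)
    qed
    have "compile (PrimRec f g) as z = Seq (compile f bs z) (Seq (Copy a (z + 2) (z + 3))
        (Seq (While (z + 2) body) (Clear (z + 1))))"
      by (simp add: Cons body_def)
    moreover have "(s, t) \<in> sem \<dots> \<longleftrightarrow>
        (\<exists>y0. rec_eval f ?xs y0 \<and> (\<exists>y. rec_eval (PrimRec f g) (s a # ?xs) y \<and> t = s(z := y)))"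
      using 1
    proof (rule sem_Seq_partial)
      show "(s(z := y0), t) \<in> sem (Seq (Copy a (z + 2) (z + 3)) (Seq (While (z + 2) body) (Clear (z + 1))))
        \<longleftrightarrow> (\<exists>y. rec_eval (PrimRec f g) (s a # ?xs) y \<and> t = s(z := y))" if "rec_eval f ?xs y0" for y0
        unfolding sem_Seq_functional[OF 2] using loop[OF that] 3 by (rule sem_Seq_partial)
    qed
    ultimately have "(s, t) \<in> sem (compile (PrimRec f g) as z) \<longleftrightarrow>
        (\<exists>y0. rec_eval f ?xs y0 \<and> (\<exists>y. rec_eval (PrimRec f g) (s a # ?xs) y \<and> t = s(z := y)))"
      by (simp only:)
    also have "\<dots> \<longleftrightarrow> (\<exists>y. rec_eval (PrimRec f g) (map s as) y \<and> t = s(z := y))"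
      using rec_eval_PrimRec_downward[of f g "s a" ?xs _ 0] Cons
      by (auto simp: rec_eval_PrimRec_0_iff)
    finally show ?thesis .
  qed
qed

lemma rec_eval_Minim_iff:
  "rec_eval (Minim f) xs n \<longleftrightarrow>
    rec_eval f (n # xs) 0 \<and> (\<forall>m<n. \<exists>y. rec_eval f (m # xs) (Suc y))"
  by (auto elim: rec_eval_MinimE intro: rec_eval.Minim)

text \<open>\<open>?S n y\<close> is the store after candidate \<open>n\<close> in \<open>z\<close>
  has been tested with outcome \<open>y\<close> in \<open>z + 1\<close>. The invariant adds that all
  smaller candidates had a positive outcome.\<close>

lemma compiles_Minim:
  assumes f: "compiles f"
  shows "compiles (Minim f)"
  unfolding compiles_def
proof (intro allI impI)
  fix as z and s t :: store
  assume as: "\<forall>a \<in> set as. a < z" and s: "\<forall>r \<ge> z. s r = 0"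
  let ?xs = "map s as"
  let ?S = "\<lambda>n y. s(z := n, z + 1 := y)"
  define body where "body = Seq (Clear (z + 1)) (Seq (Inc z) (compile f (z # as) (z + 1)))"
  define R where "R = {(s, t). s (z + 1) \<noteq> 0} \<inter> sem body"
  have cf: "(s(z := n), u) \<in> sem (compile f (z # as) (z + 1)) \<longleftrightarrow>
      (\<exists>y. rec_eval f (n # ?xs) y \<and> u = ?S n y)" for n u
  proof -
    have "map (s(z := n)) (z # as) = n # ?xs" using as by auto
    then show ?thesis
      using compilesD[OF f, of "z # as" "z + 1" "s(z := n)" u] as s by fastforce
  qed
  have body: "(?S n y, u) \<in> sem body \<longleftrightarrow> (\<exists>y'. rec_eval f (Suc n # ?xs) y' \<and> u = ?S (Suc n) y')"
    for n y u
  proof -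
    have "(?S n y)(z + 1 := 0, z := Suc n) = s(z := Suc n)" using s by (auto simp: fun_eq_iff)
    then have "(?S n y, u) \<in> sem body \<longleftrightarrow> (s(z := Suc n), u) \<in> sem (compile f (z # as) (z + 1))"
      by (simp add: body_def relcomp_unfold sem_Clear)
    then show ?thesis using cf by simp
  qed
  have sound: "\<exists>n y. u = ?S n y \<and> rec_eval f (n # ?xs) y \<and> (\<forall>m<n. \<exists>y. rec_eval f (m # ?xs) (Suc y))"
    if "(?S 0 y0, u) \<in> R\<^sup>*" "rec_eval f (0 # ?xs) y0" for y0 u
    using that(1)
  proof (induction rule: rtrancl_induct)
    case base
    show ?case using that(2) by blast
  next
    case (step u v)
    then obtain n y where u: "u = ?S n y" "rec_eval f (n # ?xs) y"
      "\<forall>m<n. \<exists>y. rec_eval f (m # ?xs) (Suc y)" by blast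
    moreover from step.hyps(2) u(1) have "y \<noteq> 0" unfolding R_def by auto
    moreover from step.hyps(2) u(1) obtain y' where
      "rec_eval f (Suc n # ?xs) y'" "v = ?S (Suc n) y'"
      unfolding R_def using body by auto
    ultimately show ?case by (metis less_Suc_eq not0_implies_Suc)
  qed
  have complete: "\<exists>y. (?S 0 y0, ?S m y) \<in> R\<^sup>* \<and> rec_eval f (m # ?xs) y"
    if h: "rec_eval f (0 # ?xs) y0" "rec_eval f (n # ?xs) 0"
      "\<forall>m<n. \<exists>y. rec_eval f (m # ?xs) (Suc y)" "m \<le> n" for y0 n m
    using h(4)
  proof (induction m)
    case 0
    show ?case using h(1) by blast
  next
    case (Suc m)
    then obtain y where y: "(?S 0 y0, ?S m y) \<in> R\<^sup>*" "rec_eval f (m # ?xs) y"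
      by (meson Suc_leD)
    then have "y \<noteq> 0" using h(3) Suc.prems rec_eval_deterministic
      by (metis Suc_le_lessD nat.distinct(1))
    moreover obtain v where v: "rec_eval f (Suc m # ?xs) v"
      using h(2,3) Suc.prems by (metis le_neq_implies_less)
    ultimately have "(?S m y, ?S (Suc m) v) \<in> R"
      unfolding R_def using body by auto
    then show ?case using y(1) v by (meson rtrancl.rtrancl_into_rtrancl)
  qed
  have S0: "?S n 0 = s(z := n)" for n using s by (auto simp: fun_eq_iff)
  have loop: "(?S 0 y0, u) \<in> sem (While (z + 1) body) \<longleftrightarrow>
      (\<exists>n. rec_eval (Minim f) ?xs n \<and> u = s(z := n))"
    if y0: "rec_eval f (0 # ?xs) y0" for y0 u
  proof
    assume "(?S 0 y0, u) \<in> sem (While (z + 1) body)"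
    then have "(?S 0 y0, u) \<in> R\<^sup>*" "u (z + 1) = 0"
      by (auto simp: R_def)
    then show "\<exists>n. rec_eval (Minim f) ?xs n \<and> u = s(z := n)"
      using sound[OF _ y0, of u] S0 unfolding rec_eval_Minim_iff by auto
  next
    assume "\<exists>n. rec_eval (Minim f) ?xs n \<and> u = s(z := n)"
    then obtain n where n: "rec_eval f (n # ?xs) 0" "\<forall>m<n. \<exists>y. rec_eval f (m # ?xs) (Suc y)"
      "u = s(z := n)" unfolding rec_eval_Minim_iff by blast
    then have "(?S 0 y0, ?S n 0) \<in> R\<^sup>*"
      using complete[OF y0 n(1,2), of n] rec_eval_deterministic by blast
    then show "(?S 0 y0, u) \<in> sem (While (z + 1) body)"
      using n(3) S0[of n] s by (simp add: R_def)
  qed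
  have "s(z := 0) = s" using s by auto
  then have 1: "(s, u) \<in> sem (compile f (z # as) (z + 1)) \<longleftrightarrow>
      (\<exists>y. rec_eval f (0 # ?xs) y \<and> u = ?S 0 y)" for u
    using cf[of 0 u] by simp
  have "compile (Minim f) as z = Seq (compile f (z # as) (z + 1)) (While (z + 1) body)"
    by (simp add: body_def)
  moreover have "(s, t) \<in> sem \<dots> \<longleftrightarrow>
      (\<exists>y0. rec_eval f (0 # ?xs) y0 \<and> (\<exists>n. rec_eval (Minim f) ?xs n \<and> t = s(z := n)))"
    using 1 loop by (rule sem_Seq_partial)
  ultimately have "(s, t) \<in> sem (compile (Minim f) as z) \<longleftrightarrow>
      (\<exists>y0. rec_eval f (0 # ?xs) y0 \<and> (\<exists>n. rec_eval (Minim f) ?xs n \<and> t = s(z := n)))"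
    by (simp only:)
  \<comment> \<open>If the least zero is \<open>n\<close>, the test of candidate 0 has a value: 0
    when \<open>n = 0\<close>, a successor otherwise.\<close>
  also have "\<dots> \<longleftrightarrow> (\<exists>n. rec_eval (Minim f) ?xs n \<and> t = s(z := n))"
    by (metis rec_eval_Minim_iff neq0_conv)
  finally show "(s, t) \<in> sem (compile (Minim f) as z) \<longleftrightarrow>
      (\<exists>y. rec_eval (Minim f) (map s as) y \<and> t = s(z := y))" .
qed

theorem compiles: "compiles f"
proof (induction f)
  case Zero
  have "rec_eval Zero xs y \<longleftrightarrow> y = 0" for xs y
    by (auto elim: rec_eval_ZeroE intro: rec_eval.Zero)
  then show ?case unfolding compiles_def by (auto simp: fun_upd_idem)
next
  case Succ
  have rec: "rec_eval Succ xs y \<longleftrightarrow> length xs = 1 \<and> y = Suc (hd xs)" for xs y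
    by (auto simp: length_Suc_conv elim: rec_eval_SuccE intro: rec_eval.Succ)
  have succ: "(s, t) \<in> sem (compile Succ [a] z) \<longleftrightarrow> t = s(z := Suc (s a))"
    if "a < z" "\<forall>r \<ge> z. s r = 0" for s t a z
    using that sem_Copy[of a z "z + 1" s] by (auto simp: relcomp_unfold)
  have "(s, t) \<in> sem (compile Succ as z) \<longleftrightarrow>
      (\<exists>y. rec_eval Succ (map s as) y \<and> t = s(z := y))"
    if "\<forall>a \<in> set as. a < z" "\<forall>r \<ge> z. s r = 0" for as z s t
  proof (cases "length as = 1")
    case True
    then obtain a where "as = [a]" by (auto simp: length_Suc_conv)
    with that show ?thesis using succ[of a z s t] rec by (simp del: compile.simps)
  qed (simp add: rec sem_Diverge)
  then show ?case unfolding compiles_def by blast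
next
  case (Proj i)
  have "rec_eval (Proj i) xs y \<longleftrightarrow> i < length xs \<and> y = xs ! i" for xs y
    by (auto elim: rec_eval_ProjE intro: rec_eval.Proj)
  moreover have "as ! i \<noteq> z \<and> as ! i \<noteq> Suc z" if "\<forall>a \<in> set as. a < z" "i < length as" for as z
    using that by (metis less_SucI less_irrefl nth_mem)
  ultimately show ?case
    unfolding compiles_def by (auto simp: sem_Diverge sem_Copy)
next
  case (Comp f gs)
  then show ?case by (rule compiles_Comp)
next
  case (PrimRec f g)
  then show ?case by (rule compiles_PrimRec)
next
  case (Minim f)
  then show ?case by (rule compiles_Minim)
qed

section \<open>Finite control\<close>

datatype instr = Nop | Add nat | Sub nat | Nonzero nat | IsZero nat

primrec instr_rel :: "instr \<Rightarrow> (store \<times> store) set" where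
  "instr_rel Nop = Id"
| "instr_rel (Add r) = {(s, t). t = s(r := Suc (s r))}"
| "instr_rel (Sub r) = {(s, t). s r \<noteq> 0 \<and> t = s(r := s r - 1)}"
| "instr_rel (Nonzero r) = {(s, t). s r \<noteq> 0 \<and> t = s}"
| "instr_rel (IsZero r) = {(s, t). s r = 0 \<and> t = s}"

definition machine_step :: "('q \<times> instr \<times> 'q) set \<Rightarrow> (('q \<times> store) \<times> ('q \<times> store)) set" where
  "machine_step T = {((q, s), (q', s')). \<exists>i. (q, i, q') \<in> T \<and> (s, s') \<in> instr_rel i}"

text \<open>The control states are continuations, i.e. lists of commands still to be executed.\<close>

primrec transitions :: "com \<Rightarrow> com list \<Rightarrow> (com list \<times> instr \<times> com list) set" where
  "transitions Skip k = {(Skip # k, Nop, k)}"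
| "transitions (Inc r) k = {(Inc r # k, Add r, k)}"
| "transitions (Dec r) k = {(Dec r # k, Sub r, k)}"
| "transitions (Seq c d) k =
     {(Seq c d # k, Nop, c # d # k)} \<union> transitions c (d # k) \<union> transitions d k"
| "transitions (While r c) k =
     {(While r c # k, Nonzero r, c # While r c # k), (While r c # k, IsZero r, k)}
     \<union> transitions c (While r c # k)"

lemma finite_transitions: "finite (transitions c k)"
  by (induction c arbitrary: k) auto

lemma machine_stepI:
  "(q, i, q') \<in> T \<Longrightarrow> (s, s') \<in> instr_rel i \<Longrightarrow> ((q, s), (q', s')) \<in> machine_step T"
  unfolding machine_step_def by blast

text \<open>\<open>T\<close> may be larger than \<open>transitions c k\<close>, so that the
  induction hypotheses for parts of a program apply to runs of the whole.\<close>

lemma transitions_complete: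
  assumes "transitions c k \<subseteq> T" "(s, t) \<in> sem c"
  shows "((c # k, s), (k, t)) \<in> (machine_step T)\<^sup>*"
  using assms
proof (induction c arbitrary: k s t)
  case Skip
  then show ?case by (intro r_into_rtrancl machine_stepI[where i = Nop]) auto
next
  case (Inc r)
  then show ?case by (intro r_into_rtrancl machine_stepI[where i = "Add r"]) auto
next
  case (Dec r)
  then show ?case by (intro r_into_rtrancl machine_stepI[where i = "Sub r"]) auto
next
  case (Seq c d)
  then obtain u where u: "(s, u) \<in> sem c" "(u, t) \<in> sem d" by auto
  have "((Seq c d # k, s), (c # d # k, s)) \<in> machine_step T"
    using Seq.prems by (auto intro!: machine_stepI[where i = Nop])
  moreover have "((c # d # k, s), (d # k, u)) \<in> (machine_step T)\<^sup>*"
    using Seq.IH(1)[of "d # k"] Seq.prems u by simp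
  moreover have "((d # k, u), (k, t)) \<in> (machine_step T)\<^sup>*"
    using Seq.IH(2)[of k] Seq.prems u by simp
  ultimately show ?case by (meson converse_rtrancl_into_rtrancl rtrancl_trans)
next
  case (While r c)
  let ?W = "While r c # k"
  have "(s, t) \<in> ({(s, t). s r \<noteq> 0} \<inter> sem c)\<^sup>*" and t: "t r = 0" using While.prems by auto
  from this(1) have "((?W, s), (?W, t)) \<in> (machine_step T)\<^sup>*"
  proof (induction rule: rtrancl_induct)
    case (step u v)
    have "((?W, u), (c # ?W, u)) \<in> machine_step T"
      using While.prems step.hyps by (auto intro!: machine_stepI[where i = "Nonzero r"])
    moreover have "((c # ?W, u), (?W, v)) \<in> (machine_step T)\<^sup>*"
      using While.IH[of ?W u v] While.prems step.hyps by simp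
    ultimately show ?case using step.IH
      by (meson converse_rtrancl_into_rtrancl rtrancl_trans)
  qed simp
  moreover have "((?W, t), (k, t)) \<in> machine_step T"
    using While.prems t by (auto intro!: machine_stepI[where i = "IsZero r"])
  ultimately show ?case by (meson rtrancl.rtrancl_into_rtrancl)
qed

primrec sem_list :: "com list \<Rightarrow> (store \<times> store) set" where
  "sem_list [] = Id"
| "sem_list (c # k) = sem c O sem_list k"

text \<open>Continuations denote relations through \<open>sem_list\<close>, and each transition is
  sound backwards: whatever \<open>q'\<close> yields after the instruction, \<open>q\<close> yields
  before it. Following a run back from the empty continuation then bounds the machine by
  \<open>sem\<close>.\<close>

lemma transitions_sound:
  assumes "(q, i, q') \<in> transitions c k" "(s, s') \<in> instr_rel i" "(s', t) \<in> sem_list q'"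
  shows "(s, t) \<in> sem_list q"
  using assms
proof (induction c arbitrary: k)
  case (While r c)
  consider "q = While r c # k" "i = Nonzero r" "q' = c # While r c # k"
    | "q = While r c # k" "i = IsZero r" "q' = k"
    | "(q, i, q') \<in> transitions c (While r c # k)"
    using While.prems(1) by auto
  then show ?case
  proof cases
    case 1
    then obtain u v where "(s, u) \<in> sem c" "(u, v) \<in> sem (While r c)" "(v, t) \<in> sem_list k" "s r \<noteq> 0"
      using While.prems by auto
    then show ?thesis using 1 sem_While_unfold[of s v r c] by (auto simp del: sem.simps)
  next
    case 2
    then show ?thesis using While.prems sem_While_unfold[of s s r c] by (auto simp del: sem.simps)
  qed (use While in blast)
qed (auto simp: O_assoc)

lemma sem_iff_machine_steps:
  "(s, t) \<in> sem c \<longleftrightarrow> (([c], s), ([], t)) \<in> (machine_step (transitions c []))\<^sup>*"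
proof
  assume "(s, t) \<in> sem c"
  then show "(([c], s), ([], t)) \<in> (machine_step (transitions c []))\<^sup>*"
    by (rule transitions_complete[OF subset_refl])
next
  have "(s, t) \<in> sem_list q" if "((q, s), ([], t)) \<in> (machine_step (transitions c []))\<^sup>*" for q s
    using that
  proof (induction "(q, s)" arbitrary: q s rule: converse_rtrancl_induct)
    case base
    then show ?case by simp
  next
    case (step y q s)
    then show ?case
      by (cases y) (auto simp: machine_step_def intro: transitions_sound)
  qed
  then show "(s, t) \<in> sem c" if "(([c], s), ([], t)) \<in> (machine_step (transitions c []))\<^sup>*"
    using that by fastforce
qed

section \<open>Affine rewriting of numbers\<close>

definition affine_step :: "(nat \<times> nat \<times> nat \<times> nat) set \<Rightarrow> (nat \<times> nat) set" where
  "affine_step Rs = {(d * m + r, c * m + e) | d r c e m. (d, r, c, e) \<in> Rs}"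

lemma affine_step_iff:
  "(N, N') \<in> affine_step Rs \<longleftrightarrow> (\<exists>(d, r, c, e) \<in> Rs. \<exists>m. N = d * m + r \<and> N' = c * m + e)"
  unfolding affine_step_def by blast

definition pr :: "nat \<Rightarrow> nat" where
  "pr = enumerate {p. prime p}"

lemma prime_pr: "prime (pr i)"
  using enumerate_in_set[OF primes_infinite] by (simp add: pr_def)

lemma pr_eq_iff: "pr i = pr j \<longleftrightarrow> i = j"
  using strict_mono_enumerate[OF primes_infinite] by (simp add: pr_def strict_mono_eq)

lemma pr_0: "pr 0 = 2"
  unfolding pr_def enumerate_0 by (rule Least_equality) (auto simp: prime_ge_2_nat)

text \<open>Finitely many transitions mention finitely many registers, so a bound \<open>k\<close>
  suffices.\<close>

definition goedel :: "nat \<Rightarrow> store \<Rightarrow> nat" where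
  "goedel k s = (\<Prod>i<k. pr i ^ s i)"

lemma goedel_pos: "goedel k s > 0"
  unfolding goedel_def using prime_pr by (simp add: prod_pos prime_gt_0_nat)

lemma goedel_Suc: "r < k \<Longrightarrow> goedel k (s(r := Suc (s r))) = pr r * goedel k s"
  unfolding goedel_def by (simp add: prod.remove[of "{..<k}" r])

lemma goedel_pred:
  assumes "r < k" "s r \<noteq> 0"
  shows "goedel k s = pr r * goedel k (s(r := s r - 1))"
proof -
  have "s = (s(r := s r - 1))(r := Suc ((s(r := s r - 1)) r))" using assms by auto
  then show ?thesis using goedel_Suc[OF assms(1)] by metis
qed

lemma dvd_goedel_iff: "r < k \<Longrightarrow> pr r dvd goedel k s \<longleftrightarrow> s r \<noteq> 0"
proof
  assume r: "r < k" and "pr r dvd goedel k s"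
  then obtain i where "i < k" "pr r dvd pr i ^ s i"
    unfolding goedel_def using prime_pr[of r] by (auto simp: prime_dvd_prod_iff)
  then show "s r \<noteq> 0"
    using prime_pr by (metis pr_eq_iff power_0 prime_dvd_power primes_dvd_imp_eq not_prime_unit)
next
  assume "r < k" "s r \<noteq> 0"
  then show "pr r dvd goedel k s" using goedel_pred by simp
qed

primrec instr_reg :: "instr \<Rightarrow> nat" where
  "instr_reg Nop = 0"
| "instr_reg (Add r) = r"
| "instr_reg (Sub r) = r"
| "instr_reg (Nonzero r) = r"
| "instr_reg (IsZero r) = r"

text \<open>Register \<open>r\<close> is zero iff \<open>pr r\<close> does not divide the Goedel
  number. One affine rule tests for one residue only, so the zero test needs a rule for each nonzero
  residue.\<close>

primrec instr_rules :: "instr \<Rightarrow> (nat \<times> nat \<times> nat \<times> nat) set" where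
  "instr_rules Nop = {(1, 0, 1, 0)}"
| "instr_rules (Add r) = {(1, 0, pr r, 0)}"
| "instr_rules (Sub r) = {(pr r, 0, 1, 0)}"
| "instr_rules (Nonzero r) = {(pr r, 0, pr r, 0)}"
| "instr_rules (IsZero r) = (\<lambda>j. (pr r, j, pr r, j)) ` {0<..<pr r}"

lemma instr_rules_simulate:
  assumes "instr_reg i < k"
  shows "(goedel k s, g) \<in> affine_step (instr_rules i) \<longleftrightarrow>
    (\<exists>s'. (s, s') \<in> instr_rel i \<and> g = goedel k s')"
proof (cases i)
  case Nop
  then show ?thesis by (auto simp: affine_step_def)
next
  case (Add r)
  then show ?thesis using assms by (auto simp: affine_step_def goedel_Suc)
next
  case (Sub r)
  have "(\<exists>m. goedel k s = pr r * m \<and> g = m) \<longleftrightarrow> s r \<noteq> 0 \<and> g = goedel k (s(r := s r - 1))"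
    using goedel_pred[of r k s] dvd_goedel_iff[of r k s] assms Sub prime_gt_0_nat[OF prime_pr[of r]]
    by auto
  then show ?thesis using Sub by (auto simp: affine_step_def)
next
  case (Nonzero r)
  have "(\<exists>m. goedel k s = pr r * m \<and> g = pr r * m) \<longleftrightarrow> s r \<noteq> 0 \<and> g = goedel k s"
    using dvd_goedel_iff[of r k s] assms Nonzero by (auto simp: dvd_def)
  then show ?thesis using Nonzero by (auto simp: affine_step_def)
next
  case (IsZero r)
  have "(\<exists>m j. 0 < j \<and> j < pr r \<and> goedel k s = pr r * m + j) \<longleftrightarrow> \<not> pr r dvd goedel k s"
  proof
    assume "\<exists>m j. 0 < j \<and> j < pr r \<and> goedel k s = pr r * m + j"
    then show "\<not> pr r dvd goedel k s" by (auto simp: dvd_add_right_iff nat_dvd_not_less)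
  next
    assume "\<not> pr r dvd goedel k s"
    moreover have "goedel k s = pr r * (goedel k s div pr r) + goedel k s mod pr r" by simp
    moreover have "goedel k s mod pr r < pr r" using prime_gt_0_nat[OF prime_pr] by simp
    ultimately show "\<exists>m j. 0 < j \<and> j < pr r \<and> goedel k s = pr r * m + j"
      by (metis dvd_eq_mod_eq_0 neq0_conv)
  qed
  then have "(\<exists>m j. 0 < j \<and> j < pr r \<and> goedel k s = pr r * m + j \<and> g = pr r * m + j) \<longleftrightarrow>
      s r = 0 \<and> g = goedel k s"
    using dvd_goedel_iff[of r k s] assms IsZero by auto
  then show ?thesis using IsZero by (fastforce simp: affine_step_def)
qed

lemma finite_instr_rules: "finite (instr_rules i)"
  by (cases i) auto

lemma instr_rules_pos: "(d, r, c, e) \<in> instr_rules i \<Longrightarrow> d > 0"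
  using prime_gt_0_nat[OF prime_pr] by (cases i) auto

text \<open>The control state is kept as the residue modulo the number \<open>Q\<close> of states
  and the Goedel number as the quotient; instruction rules are lifted to act on the quotient. One
  further rule sends every code of the final state \<open>f\<close> to 0.\<close>

theorem machine_halting_iff_affine_reach:
  fixes T :: "('q \<times> instr \<times> 'q) set"
  assumes "finite T"
  shows "\<exists>Rs t a. finite Rs \<and> (\<forall>(d, r, c, e) \<in> Rs. d > 0) \<and>
    (\<forall>n. (t * 2 ^ n + a, 0) \<in> (affine_step Rs)\<^sup>* \<longleftrightarrow>
      (\<exists>u. ((p, (\<lambda>_. 0)(0 := n)), (f, u)) \<in> (machine_step T)\<^sup>*))"
proof -
  define F where "F = {p, f} \<union> fst ` T \<union> (\<lambda>x. snd (snd x)) ` T"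
  have "finite F" using assms by (simp add: F_def)
  from finite_imp_inj_to_nat_seg[OF this] obtain idx :: "'q \<Rightarrow> nat" and Q
    where idx: "idx ` F = {i. i < Q}" "inj_on idx F" by auto
  have T_F: "q \<in> F \<and> q' \<in> F" if "(q, i, q') \<in> T" for q i q'
    using that unfolding F_def by force
  have idx_less: "idx q < Q" if "q \<in> F" for q using that idx(1) by blast
  have "p \<in> F" "f \<in> F" by (auto simp: F_def)
  then have "Q > 0" using idx_less by fastforce
  define k where "k = Suc (Max (insert 0 ((\<lambda>x. instr_reg (fst (snd x))) ` T)))"
  have k: "instr_reg i < k" if "(q, i, q') \<in> T" for q i q'
    unfolding k_def less_Suc_eq_le using that assms by (intro Max_ge) force+
  define enc where "enc = (\<lambda>(q, s). Q * goedel k s + idx q)"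
  define lift :: "nat \<Rightarrow> nat \<Rightarrow> nat \<times> nat \<times> nat \<times> nat \<Rightarrow> nat \<times> nat \<times> nat \<times> nat" where
    "lift = (\<lambda>a b (d, r, c, e). (Q * d, Q * r + a, Q * c, Q * e + b))"
  define Rs where "Rs = insert (Q, idx f, 0, 0)
    (\<Union>(q, i, q') \<in> T. lift (idx q) (idx q') ` instr_rules i)"
  have unique: "Q * x + a = Q * y + b \<longleftrightarrow> x = y \<and> a = b" if "a < Q" "b < Q" for x y a b
  proof -
    have "(Q * x + a) div Q = x \<and> (Q * x + a) mod Q = a" if "a < Q" for x a
      using that by simp
    then show ?thesis using that by metis
  qed
  have lift: "(Q * g + a, N) \<in> affine_step (lift a' b ` S) \<longleftrightarrow>
      a = a' \<and> (\<exists>g'. (g, g') \<in> affine_step S \<and> N = Q * g' + b)"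
    if "a < Q" "a' < Q" for g a a' b N S
  proof -
    have "Q * d * m + (Q * r + a') = Q * (d * m + r) + a'" for d m r
      by (simp add: algebra_simps)
    then have "Q * g + a = Q * d * m + (Q * r + a') \<longleftrightarrow> g = d * m + r \<and> a = a'" for d m r
      using unique[OF that] by metis
    moreover have "Q * c * m + (Q * e + b) = Q * (c * m + e) + b" for c m e
      by (simp add: algebra_simps)
    ultimately show ?thesis
      unfolding affine_step_iff lift_def bex_simps by (simp only: case_prod_unfold fst_conv snd_conv) blast
  qed
  have enc_step: "(enc (q, s), N) \<in> affine_step Rs \<longleftrightarrow> q = f \<and> N = 0 \<or>
      (\<exists>q' s'. ((q, s), (q', s')) \<in> machine_step T \<and> N = enc (q', s'))" if q: "q \<in> F" for q s N
  proof -
    have union: "affine_step (insert x (\<Union>y \<in> T. h y)) =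
        affine_step {x} \<union> (\<Union>y \<in> T. affine_step (h y))" for x h
      unfolding affine_step_def by blast
    have final: "(Q * g + idx q, N) \<in> affine_step {(Q, idx f, 0, 0)} \<longleftrightarrow> q = f \<and> N = 0" for g
      using unique[OF idx_less[OF q] idx_less[OF \<open>f \<in> F\<close>]] inj_onD[OF idx(2) _ q \<open>f \<in> F\<close>]
      by (auto simp: affine_step_def)
    have "(Q * goedel k s + idx q, N) \<in> affine_step (lift (idx p) (idx q') ` instr_rules i) \<longleftrightarrow>
        q = p \<and> (\<exists>s'. (s, s') \<in> instr_rel i \<and> N = enc (q', s'))" if "(p, i, q') \<in> T" for p i q'
      using lift[OF idx_less[OF q] idx_less[of p]] instr_rules_simulate[OF k[OF that]]
        T_F[OF that] inj_onD[OF idx(2) _ q, of p] by (auto simp: enc_def)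
    then have "(\<exists>y \<in> T. (Q * goedel k s + idx q, N) \<in>
          affine_step (case y of (p, i, q') \<Rightarrow> lift (idx p) (idx q') ` instr_rules i)) \<longleftrightarrow>
        (\<exists>(p, i, q') \<in> T. q = p \<and> (\<exists>s'. (s, s') \<in> instr_rel i \<and> N = enc (q', s')))"
      by (intro bex_cong refl) (auto split: prod.split)
    moreover have "\<dots> \<longleftrightarrow> (\<exists>q' s'. ((q, s), (q', s')) \<in> machine_step T \<and> N = enc (q', s'))"
      unfolding machine_step_def by auto
    ultimately show ?thesis
      unfolding Rs_def union by (simp add: enc_def final)
  qed
  let ?s = "\<lambda>n. (\<lambda>_. 0)(0 := n) :: store"
  have "(enc (p, ?s n), 0) \<in> (affine_step Rs)\<^sup>* \<longleftrightarrow>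
      (\<exists>u. ((p, ?s n), (f, u)) \<in> (machine_step T)\<^sup>*)" for n
  proof
    \<comment> \<open>The final state can be rewritten to 0, and 0 may be rewritten further. The
      invariant therefore describes \<open>N\<close> only as long as \<open>f\<close> has not been
      reached.\<close>
    have "(\<exists>u. ((p, ?s n), (f, u)) \<in> (machine_step T)\<^sup>*) \<or>
        (\<exists>q u. q \<in> F \<and> ((p, ?s n), (q, u)) \<in> (machine_step T)\<^sup>* \<and> N = enc (q, u))"
      if "(enc (p, ?s n), N) \<in> (affine_step Rs)\<^sup>*" for N
      using that
    proof (induction rule: rtrancl_induct)
      case base
      then show ?case using \<open>p \<in> F\<close> by blast
    next
      case (step N N')
      show ?case
      proof (cases "\<exists>u. ((p, ?s n), (f, u)) \<in> (machine_step T)\<^sup>*")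
        case False
        then obtain q u where qu: "q \<in> F" "((p, ?s n), (q, u)) \<in> (machine_step T)\<^sup>*" "N = enc (q, u)"
          using step.IH by blast
        then obtain q' u' where "((q, u), (q', u')) \<in> machine_step T" "N' = enc (q', u')"
          using step.hyps(2) enc_step[of q u N'] False by blast
        moreover from this have "q' \<in> F" using T_F unfolding machine_step_def by blast
        moreover have "((p, ?s n), (q', u')) \<in> (machine_step T)\<^sup>*"
          using qu(2) calculation(1) by (rule rtrancl.rtrancl_into_rtrancl)
        ultimately show ?thesis by blast
      qed blast
    qed
    \<comment> \<open>Codes are positive, so at 0 only the first alternative remains.\<close>
    moreover have "enc (q, u) \<noteq> 0" for q u
      using goedel_pos[of k u] \<open>Q > 0\<close> by (simp add: enc_def)
    ultimately show "\<exists>u. ((p, ?s n), (f, u)) \<in> (machine_step T)\<^sup>*"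
      if "(enc (p, ?s n), 0) \<in> (affine_step Rs)\<^sup>*" using that by metis
  next
    assume "\<exists>u. ((p, ?s n), (f, u)) \<in> (machine_step T)\<^sup>*"
    then obtain u where u: "((p, ?s n), (f, u)) \<in> (machine_step T)\<^sup>*" by blast
    have "(enc (p, ?s n), enc x) \<in> (affine_step Rs)\<^sup>* \<and> fst x \<in> F"
      if "((p, ?s n), x) \<in> (machine_step T)\<^sup>*" for x
      using that
    proof (induction rule: rtrancl_induct)
      case base
      then show ?case using \<open>p \<in> F\<close> by (metis fst_conv rtrancl.rtrancl_refl)
    next
      case (step x y)
      obtain q w q' w' where xy: "x = (q, w)" "y = (q', w')" by fastforce
      then have "q' \<in> F" using step.hyps(2) T_F unfolding machine_step_def by blast
      moreover have "(enc x, enc y) \<in> affine_step Rs"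
        using enc_step[of q w "enc y"] step xy by auto
      ultimately show ?case using step.IH xy by (auto intro: rtrancl.rtrancl_into_rtrancl)
    qed
    from this[OF u] have "(enc (p, ?s n), enc (f, u)) \<in> (affine_step Rs)\<^sup>*" by blast
    moreover have "(enc (f, u), 0) \<in> affine_step Rs" using enc_step[OF \<open>f \<in> F\<close>] by blast
    ultimately show "(enc (p, ?s n), 0) \<in> (affine_step Rs)\<^sup>*" by (rule rtrancl.rtrancl_into_rtrancl)
  qed
  moreover have "enc (p, ?s n) = Q * 2 ^ n + idx p" for n
  proof -
    \<comment> \<open>The input sits in register 0, whose prime is 2.\<close>
    have "goedel k (?s n) = (\<Prod>i<k. if i = 0 then 2 ^ n else 1)"
      unfolding goedel_def by (rule prod.cong) (auto simp: pr_0)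
    also have "\<dots> = 2 ^ n" by (simp add: k_def)
    finally show ?thesis by (simp add: enc_def)
  qed
  moreover have "finite Rs"
    unfolding Rs_def using assms finite_instr_rules by auto
  moreover have "\<forall>(d, r, c, e) \<in> Rs. d > 0"
    using \<open>Q > 0\<close> instr_rules_pos by (fastforce simp: Rs_def lift_def)
  ultimately show ?thesis
    by (intro exI[of _ Rs] exI[of _ Q] exI[of _ "idx p"]) simp
qed

section \<open>Tiles\<close>

definition solvable :: "(nat list \<times> nat list) set \<Rightarrow> nat list \<Rightarrow> bool" where
  "solvable X p \<longleftrightarrow> (\<exists>ts. set ts \<subseteq> X \<and> p @ concat (map snd ts) = concat (map fst ts))"

lemma solvable_Nil: "solvable X []"
  unfolding solvable_def by (rule exI[of _ "[]"]) simp

text \<open>As a queue automaton, a tile \<open>(u, v)\<close> removes \<open>u\<close> at the front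
  and appends \<open>v\<close> at the back. This is one such step, taken backwards.\<close>

lemma solvable_step: "(u, v) \<in> X \<Longrightarrow> solvable X (z @ v) \<Longrightarrow> solvable X (u @ z)"
  unfolding solvable_def
proof (elim exE conjE)
  fix ts assume "(u, v) \<in> X" "set ts \<subseteq> X" "(z @ v) @ concat (map snd ts) = concat (map fst ts)"
  then show "\<exists>ts. set ts \<subseteq> X \<and> (u @ z) @ concat (map snd ts) = concat (map fst ts)"
    by (intro exI[of _ "(u, v) # ts"]) simp
qed

lemma replicate_delimiter_eq_iff:
  assumes "x \<noteq> y"
  shows "replicate m x @ y # xs = replicate n x @ y # ys \<longleftrightarrow> m = n \<and> xs = ys"
proof (induction m arbitrary: n)
  case 0
  then show ?case using assms by (cases n) auto
next
  case (Suc m)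
  then show ?case using assms by (cases n) auto
qed

lemma hd_replicate_append_Cons: "hd (replicate n x @ y # xs) = (if n = 0 then y else x)"
  by (cases n) auto

text \<open>The number \<open>N\<close> is written as the word \<open>3 (1\<^sup>K 2)\<^bsup>N+1\<^esup>\<close>, where \<open>K\<close> is the number of rules. To apply
  rule number \<open>i\<close>, a queue automaton consumes \<open>3 1\<^bsup>i+1\<^esup>\<close>; from then on it reads the word in
  blocks shifted by \<open>i + 1\<close> letters, so that only the tiles of rule \<open>i\<close> match until the next \<open>3\<close>.
  The letters \<open>4\<close> are a unary input.\<close>

locale affine_tiles =
  fixes rl :: "(nat \<times> nat \<times> nat \<times> nat) list" and t s :: nat
  assumes divisor_pos: "(d, r, c, e) \<in> set rl \<Longrightarrow> d > 0"
begin

abbreviation K :: nat where "K \<equiv> length rl"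

definition units :: "nat \<Rightarrow> nat list" where
  "units n = concat (replicate n (replicate K 1 @ [2]))"

text \<open>The extra block is split when a rule starts: its first \<open>i + 1\<close> letters
  select the rule, and its remainder \<open>rest i\<close> shifts the reading of the
  \<open>N\<close> blocks behind it.\<close>

definition config :: "nat \<Rightarrow> nat list" where
  "config N = 3 # units (Suc N)"

definition rest :: "nat \<Rightarrow> nat list" where
  "rest i = replicate (K - Suc i) 1 @ [2]"

definition shifted :: "nat \<Rightarrow> nat \<Rightarrow> nat list" where
  "shifted i n = concat (replicate n (rest i @ replicate (Suc i) 1))"

text \<open>In this order the tiles select the rule and write the constant \<open>e\<close>, trade
  \<open>d\<close> blocks for \<open>c\<close> new ones, once for each unit of the quotient, and
  remove the remainder \<open>r\<close>.\<close>

definition rule_tiles :: "nat \<Rightarrow> nat \<times> nat \<times> nat \<times> nat \<Rightarrow> (nat list \<times> nat list) set" where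
  "rule_tiles i = (\<lambda>(d, r, c, e).
     {(3 # replicate (Suc i) 1, config e), (shifted i d, units c), (rest i @ units r, [])})"

definition tiles :: "(nat list \<times> nat list) set" where
  "tiles = {([3, 4], config s), ([4], units t), (config 0, [])} \<union> (\<Union>i<K. rule_tiles i (rl ! i))"

lemma finite_tiles: "finite tiles"
  by (auto simp: tiles_def rule_tiles_def split: prod.split)

lemma units_simps [simp]: "units 0 = []" "units (Suc n) = replicate K 1 @ 2 # units n"
  by (simp_all add: units_def)

lemma units_add: "units (m + n) = units m @ units n"
  by (simp add: units_def replicate_add)

lemma config_add: "config (x + y) = config x @ units y"
  using units_add[of "Suc x" y] by (simp add: config_def)

lemma shifted_simps: "shifted i 0 = []"
  "shifted i (Suc n) = replicate (K - Suc i) 1 @ 2 # replicate (Suc i) 1 @ shifted i n"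
  by (simp_all add: shifted_def rest_def)

lemma replicate_K_split: "i < K \<Longrightarrow> replicate K x = replicate (Suc i) x @ replicate (K - Suc i) x"
  by (metis Suc_leI le_add_diff_inverse replicate_add)

lemma shifted_rest: "i < K \<Longrightarrow> shifted i n @ rest i = rest i @ units n"
  by (induction n) (simp_all add: shifted_simps rest_def replicate_K_split[of i] del: replicate_Suc)

text \<open>A word without the letter 3 cannot match beyond the separator, and each shifted block
  uses up one unit and leaves the same shift \<open>rest i\<close>.\<close>

lemma shifted_prefix:
  assumes "i < K" "shifted i n @ Y = rest i @ units j @ 3 # Z"
  shows "n \<le> j \<and> Y = rest i @ units (j - n) @ 3 # Z"
  using assms(2)
proof (induction n arbitrary: j)
  case 0
  then show ?case by (simp add: shifted_simps)
next
  case (Suc n)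
  have *: "replicate (Suc i) 1 @ shifted i n @ Y = units j @ 3 # Z"
    using Suc.prems by (simp add: shifted_simps rest_def replicate_delimiter_eq_iff)
  then obtain j' where j: "j = Suc j'" by (cases j) auto
  with * have "shifted i n @ Y = rest i @ units j' @ 3 # Z"
    using assms(1) by (simp add: rest_def replicate_K_split[of i] del: replicate_Suc)
  then show ?case using Suc.IH[of j'] j by simp
qed

lemma units_prefix:
  "units n @ Y = units j @ 3 # Z \<Longrightarrow> n \<le> j \<and> Y = units (j - n) @ 3 # Z"
proof (induction n arbitrary: j)
  case (Suc n)
  show ?case
  proof (cases j)
    case 0
    then show ?thesis using Suc.prems by (cases K) auto
  next
    case (Suc j')
    then show ?thesis using Suc.prems Suc.IH[of j'] by (simp add: replicate_delimiter_eq_iff)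
  qed
qed simp

definition reaches_0 :: "nat \<Rightarrow> bool" where
  "reaches_0 N \<longleftrightarrow> (N, 0) \<in> (affine_step (set rl))\<^sup>*"

lemma tile_cases:
  assumes "(u, v) \<in> tiles"
  obtains "u = [3, 4]" "v = config s" | "u = [4]" "v = units t" | "u = config 0" "v = []"
    | i d r c e where "i < K" "rl ! i = (d, r, c, e)" "u = 3 # replicate (Suc i) 1" "v = config e"
    | i d r c e d' where "i < K" "rl ! i = (d, r, c, e)" "d = Suc d'" "u = shifted i d" "v = units c"
    | i d r c e where "i < K" "rl ! i = (d, r, c, e)" "u = rest i @ units r" "v = []"
proof -
  have "(u, v) \<in> {([3, 4], config s), ([4], units t), (config 0, [])} \<or>
      (\<exists>i<K. (u, v) \<in> rule_tiles i (rl ! i))"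
    using assms unfolding tiles_def by blast
  then show thesis
  proof
    assume "(u, v) \<in> {([3, 4], config s), ([4], units t), (config 0, [])}"
    then show thesis using that(1-3) by blast
  next
    assume "\<exists>i<K. (u, v) \<in> rule_tiles i (rl ! i)"
    then obtain i d r c e where i: "i < K" "rl ! i = (d, r, c, e)" "(u, v) \<in> rule_tiles i (d, r, c, e)"
      by (metis prod_cases4)
    \<comment> \<open>A positive \<open>d\<close> keeps \<open>shifted i d\<close> nonempty, so its
      initial letters identify the rule.\<close>
    moreover obtain d' where "d = Suc d'"
      using divisor_pos[of d r c e] i by (metis gr0_implies_Suc nth_mem)
    ultimately show thesis
      using that(4-6)[OF i(1,2)] unfolding rule_tiles_def by blast
  qed
qed

definition solves :: "(nat list \<times> nat list) list \<Rightarrow> nat list \<Rightarrow> bool" where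
  "solves ts p \<longleftrightarrow> set ts \<subseteq> tiles \<and> p @ concat (map snd ts) = concat (map fst ts)"

lemma solves_Cons:
  "solves ((u, v) # ts) p \<longleftrightarrow> (u, v) \<in> tiles \<and> set ts \<subseteq> tiles \<and>
    p @ v @ concat (map snd ts) = u @ concat (map fst ts)"
  by (auto simp: solves_def)

text \<open>A queue starting with an unshifted block is stuck: every tile starts with 3, with 4, or
  with fewer than \<open>K\<close> letters 1 before a 2. This rules out halting at a nonzero number
  and leaving a rule with blocks still unread.\<close>

lemma not_solves_units: "\<not> solves ts (units (Suc l) @ p)"
proof
  assume *: "solves ts (units (Suc l) @ p)"
  then obtain u v ts' where "ts = (u, v) # ts'" by (cases ts) (auto simp: solves_def)
  with * have uv: "(u, v) \<in> tiles" and
    eq: "replicate K 1 @ 2 # units l @ p @ v @ concat (map snd ts') = u @ concat (map fst ts')"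
    by (auto simp: solves_Cons)
  from uv show False
  proof (cases rule: tile_cases)
    case (5 i d r c e d')
    then have "K = K - Suc i" using eq by (simp add: shifted_simps replicate_delimiter_eq_iff)
    then show False using 5(1) by simp
  next
    case (6 i d r c e)
    then have "K = K - Suc i" using eq by (simp add: rest_def replicate_delimiter_eq_iff)
    then show False using 6(1) by simp
  qed (use arg_cong[OF eq, of hd] in
      \<open>auto simp: config_def hd_replicate_append_Cons split: if_splits\<close>)
qed

text \<open>One induction over the tiles treats two phases: the queue still holds input or shows a
  number, or rule \<open>i\<close> has made \<open>m\<close> passes with \<open>j\<close> blocks
  left. In the second phase the number being rewritten is \<open>d * m + j\<close>.\<close>

lemma solves_sound:
  "(solves ts (replicate j 4 @ config x) \<longrightarrow> reaches_0 (t * j + x)) \<and>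
   (\<forall>i d r c e m. i < K \<longrightarrow> rl ! i = (d, r, c, e) \<longrightarrow>
      solves ts (rest i @ units j @ config (c * m + e)) \<longrightarrow> reaches_0 (d * m + j))"
proof (induction ts arbitrary: j x)
  case Nil
  show ?case by (auto simp: solves_def config_def rest_def)
next
  case (Cons uv ts)
  obtain u v where uv: "uv = (u, v)" by (cases uv)
  let ?V = "concat (map snd ts)" and ?U = "concat (map fst ts)"
  have feed: "reaches_0 (t * j + x)" if "solves (uv # ts) (replicate j 4 @ config x)" for j x
  proof -
    have tile: "(u, v) \<in> tiles" and ts: "set ts \<subseteq> tiles" and
      eq: "replicate j 4 @ config x @ v @ ?V = u @ ?U"
      using that by (auto simp: uv solves_Cons)
    show ?thesis
    proof (cases j)
      case 0
      note eq = eq[unfolded 0, simplified]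
      from tile show ?thesis
      proof (cases rule: tile_cases)
        case 3
        then have "units x @ ?V = ?U" using eq by (simp add: config_def)
        then have "solves ts (units x @ [])" using ts by (simp add: solves_def)
        then have "x = 0" using not_solves_units by (metis not0_implies_Suc)
        then show ?thesis using 0 by (simp add: reaches_0_def)
      next
        case (4 i d r c e)
        then have "rest i @ units x @ config e @ ?V = ?U"
          using eq by (simp add: config_def rest_def replicate_K_split[of i] del: replicate_Suc)
        then have "solves ts (rest i @ units x @ config (c * 0 + e))"
          using ts by (simp add: solves_def)
        then have "reaches_0 (d * 0 + x)" using Cons.IH 4(1,2) by blast
        then show ?thesis using 0 by simp
      qed (use arg_cong[OF eq, of hd] arg_cong[OF eq, of "\<lambda>w. hd (tl w)"] in
          \<open>auto simp: config_def shifted_simps rest_def hd_replicate_append_Cons split: if_splits\<close>)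
    next
      case (Suc j')
      from tile show ?thesis
      proof (cases rule: tile_cases)
        case 2
        then have "(replicate j' 4 @ config (x + t)) @ ?V = ?U" using eq Suc by (simp add: config_add)
        then have "solves ts (replicate j' 4 @ config (x + t))" using ts by (simp add: solves_def)
        then have "reaches_0 (t * j' + (x + t))" using Cons.IH by blast
        then show ?thesis using Suc by (simp add: algebra_simps)
      qed (use arg_cong[OF eq, of hd] Suc in
          \<open>auto simp: config_def shifted_simps rest_def hd_replicate_append_Cons split: if_splits\<close>)
    qed
  qed
  have loop: "reaches_0 (d * m + j)"
    if i: "i < K" "rl ! i = (d, r, c, e)" and "solves (uv # ts) (rest i @ units j @ config (c * m + e))"
    for i d r c e m j
  proof -
    have tile: "(u, v) \<in> tiles" and ts: "set ts \<subseteq> tiles" and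
      eq: "rest i @ units j @ config (c * m + e) @ v @ ?V = u @ ?U"
      using that by (auto simp: uv solves_Cons)
    from tile show ?thesis
    proof (cases rule: tile_cases)
      case (5 i' d1 r1 c1 e1 d')
      \<comment> \<open>The letters 1 before the first 2 reveal the shift, so tiles of another rule
        do not fit.\<close>
      then have "K - Suc i = K - Suc i'"
        using eq by (simp add: shifted_simps rest_def replicate_delimiter_eq_iff)
      then have "i' = i" using i(1) 5(1) by simp
      then have 5: "u = shifted i d" "v = units c" using 5 i(2) by auto
      then have *: "d \<le> j \<and> ?U = rest i @ units (j - d) @ config (c * m + e) @ v @ ?V"
        using shifted_prefix[OF i(1), of d ?U j "units (Suc (c * m + e)) @ v @ ?V"] eq
        by (simp add: config_def)
      have "config (c * m + e) @ v = config (c * Suc m + e)"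
        using config_add[of "c * m + e" c] 5 by (simp add: algebra_simps)
      then have "solves ts (rest i @ units (j - d) @ config (c * Suc m + e))"
        using * ts by (simp add: solves_def)
      then have "reaches_0 (d * Suc m + (j - d))" using Cons.IH i by blast
      then show ?thesis using * by (simp add: algebra_simps)
    next
      case (6 i' d1 r1 c1 e1)
      then have "K - Suc i = K - Suc i'"
        using eq by (simp add: rest_def replicate_delimiter_eq_iff)
      then have "i' = i" using i(1) 6(1) by simp
      then have 6: "u = rest i @ units r" "v = []" using 6 i(2) by auto
      then have *: "r \<le> j \<and> ?U = units (j - r) @ config (c * m + e) @ ?V"
        using units_prefix[of r ?U j "units (Suc (c * m + e)) @ ?V"] eq by (simp add: config_def)
      then have sol: "solves ts (units (j - r) @ config (c * m + e))"
        using ts by (simp add: solves_def)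
      \<comment> \<open>Blocks left after the remainder would stand unshifted at the front, so the
        remainder is exactly \<open>r\<close>.\<close>
      then have "j - r = 0" using not_solves_units by (metis not0_implies_Suc)
      then have "solves ts (replicate 0 4 @ config (c * m + e))" and j: "j = r" using sol * by auto
      then have "reaches_0 (t * 0 + (c * m + e))" using Cons.IH by blast
      moreover have "(d * m + j, c * m + e) \<in> affine_step (set rl)"
        unfolding affine_step_def j using i nth_mem by fastforce
      ultimately show ?thesis
        unfolding reaches_0_def by (simp add: converse_rtrancl_into_rtrancl)
    qed (use arg_cong[OF eq, of hd] in
        \<open>auto simp: config_def rest_def hd_replicate_append_Cons split: if_splits\<close>)
  qed
  show ?case using feed loop by blast
qed

lemma solvable_config_complete:
  assumes "reaches_0 N"
  shows "solvable tiles (config N)"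
  using assms unfolding reaches_0_def
proof (induction rule: converse_rtrancl_induct)
  case base
  show ?case
    using solvable_step[of "config 0" "[]" tiles "[]"] solvable_Nil by (simp add: tiles_def)
next
  case (step N N')
  then obtain d r c e m where "(d, r, c, e) \<in> set rl" and N: "N = d * m + r" "N' = c * m + e"
    unfolding affine_step_def by blast
  then obtain i where i: "i < K" "rl ! i = (d, r, c, e)" by (auto simp: in_set_conv_nth)
  have tiles: "rule_tiles i (d, r, c, e) \<subseteq> tiles" using i unfolding tiles_def by force
  \<comment> \<open>Here \<open>x\<close> is the part of the result already written at the back;
    each pass adds \<open>c\<close> to it.\<close>
  have "solvable tiles (rest i @ units (d * m + r) @ config x)"
    if "solvable tiles (config (c * m + x))" for x
    using that
  proof (induction m arbitrary: x)
    case 0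
    have "(rest i @ units r, []) \<in> tiles" using tiles by (auto simp: rule_tiles_def)
    from solvable_step[OF this, of "config x"] show ?case using 0 by simp
  next
    case (Suc m)
    have "solvable tiles (rest i @ units (d * m + r) @ config (x + c))"
      using Suc by (simp add: algebra_simps)
    then have "solvable tiles ((rest i @ units (d * m + r) @ config x) @ units c)"
      by (simp add: config_add)
    moreover have "(shifted i d, units c) \<in> tiles" using tiles by (auto simp: rule_tiles_def)
    ultimately have "solvable tiles (shifted i d @ rest i @ units (d * m + r) @ config x)"
      using solvable_step by blast
    moreover have "shifted i d @ rest i @ units (d * m + r) = rest i @ units (d * Suc m + r)"
      using shifted_rest[OF i(1), of d] units_add[of d "d * m + r"]
      by (simp add: add.assoc)
    ultimately show ?case by (metis append.assoc)
  qed
  then have "solvable tiles ((rest i @ units N) @ config e)" using step.IH N by simp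
  moreover have "(3 # replicate (Suc i) 1, config e) \<in> tiles" using tiles by (auto simp: rule_tiles_def)
  ultimately have "solvable tiles ((3 # replicate (Suc i) 1) @ rest i @ units N)"
    using solvable_step by blast
  moreover have "(3 # replicate (Suc i) 1) @ rest i @ units N = config N"
    using i(1) by (simp add: config_def rest_def replicate_K_split[of i] del: replicate_Suc)
  ultimately show ?case by simp
qed

theorem solvable_tiles_iff:
  "solvable tiles (3 # replicate (Suc M) 4) \<longleftrightarrow> (t * M + s, 0) \<in> (affine_step (set rl))\<^sup>*"
proof
  assume "solvable tiles (3 # replicate (Suc M) 4)"
  then obtain ts where ts: "solves ts (3 # replicate (Suc M) 4)"
    unfolding solvable_def solves_def by blast
  then obtain u v ts' where "ts = (u, v) # ts'" by (cases ts) (auto simp: solves_def)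
  with ts have tile: "(u, v) \<in> tiles" and ts': "set ts' \<subseteq> tiles" and
    eq: "3 # 4 # replicate M 4 @ v @ concat (map snd ts') = u @ concat (map fst ts')"
    by (auto simp: solves_Cons)
  from tile have "u = [3, 4]" "v = config s"
    by (cases rule: tile_cases;
      use arg_cong[OF eq, of hd] arg_cong[OF eq, of "\<lambda>w. hd (tl w)"] in
        \<open>auto simp: config_def shifted_simps rest_def hd_replicate_append_Cons split: if_splits\<close>)+
  then have "solves ts' (replicate M 4 @ config s)" using eq ts' by (simp add: solves_def)
  then show "(t * M + s, 0) \<in> (affine_step (set rl))\<^sup>*"
    using solves_sound unfolding reaches_0_def by blast
next
  have feed: "solvable tiles (replicate j 4 @ config x)" if "solvable tiles (config (t * j + x))" for j x
    using that
  proof (induction j arbitrary: x)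
    case (Suc j)
    then have "solvable tiles (config (t * j + (x + t)))" by (simp add: algebra_simps)
    from Suc.IH[OF this] have "solvable tiles ((replicate j 4 @ config x) @ units t)"
      by (simp add: config_add)
    then have "solvable tiles ([4] @ replicate j 4 @ config x)"
      by (rule solvable_step[rotated]) (simp add: tiles_def)
    then show ?case by simp
  qed simp
  assume "(t * M + s, 0) \<in> (affine_step (set rl))\<^sup>*"
  then have "solvable tiles (replicate M 4 @ config s)"
    using feed solvable_config_complete unfolding reaches_0_def by blast
  then have "solvable tiles ([3, 4] @ replicate M 4)"
    by (rule solvable_step[rotated]) (simp add: tiles_def)
  then show "solvable tiles (3 # replicate (Suc M) 4)" by simp
qed

lemma fst_tile_not_Nil: "(u, v) \<in> tiles \<Longrightarrow> u \<noteq> []"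
  by (cases rule: tile_cases) (auto simp: config_def shifted_simps rest_def)

lemma tile_letters: "(u, v) \<in> tiles \<Longrightarrow> set u \<subseteq> {1..4} \<and> set v \<subseteq> {1..4}"
proof -
  have units: "set (units n) \<subseteq> {1..4}" for n by (auto simp: units_def)
  then have config: "set (config n) \<subseteq> {1..4}" for n by (auto simp: config_def simp del: units_simps)
  have rest: "set (rest i) \<subseteq> {1..4}" and shifted: "set (shifted i n) \<subseteq> {1..4}" for i n
    by (auto simp: shifted_def rest_def)
  show "set u \<subseteq> {1..4} \<and> set v \<subseteq> {1..4}" if "(u, v) \<in> tiles"
    using that by (cases rule: tile_cases) 
      (simp_all add: units config rest shifted set_replicate_conv_if del: One_nat_def)
qed

end

section \<open>Matrices\<close>

definition num :: "nat list \<Rightarrow> int" where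
  "num w = foldl (\<lambda>x d. 5 * x + int d) 0 w"

lemma num_Nil [simp]: "num [] = 0"
  by (simp add: num_def)

lemma num_snoc: "num (w @ [d]) = 5 * num w + int d"
  by (simp add: num_def)

lemma num_append: "num (u @ v) = num u * 5 ^ length v + num v"
proof (induction v rule: rev_induct)
  case (snoc d v)
  have "num (u @ v @ [d]) = 5 * num (u @ v) + int d"
    using num_snoc[of "u @ v" d] by simp
  then show ?case using snoc by (simp add: num_snoc algebra_simps)
qed simp

lemma num_nonneg: "num w \<ge> 0"
  by (induction w rule: rev_induct) (auto simp: num_snoc)

text \<open>The digit 0 does not occur, so the value determines the length as well.\<close>

lemma num_inject:
  assumes "set u \<subseteq> {1..4}" "set v \<subseteq> {1..4}" "num u = num v"
  shows "u = v"
  using assms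
proof (induction u arbitrary: v rule: rev_induct)
  case Nil
  then show ?case
    using num_nonneg by (cases v rule: rev_cases) (auto simp: num_snoc add_nonneg_eq_0_iff)
next
  case (snoc d u)
  show ?case
  proof (cases v rule: rev_cases)
    case Nil
    then show ?thesis using snoc.prems num_nonneg[of u] by (auto simp: num_snoc)
  next
    case (snoc v' d')
    then have "5 * num u + int d = 5 * num v' + int d'" "d \<in> {1..4}" "d' \<in> {1..4}"
      using snoc.prems by (auto simp: num_snoc)
    then have "num u = num v'" "d = d'" by auto presburger+
    then show ?thesis using snoc snoc.IH[of v'] snoc.prems by auto
  qed
qed

lemma sum_UNIV_4: "sum f (UNIV :: 4 set) = f 0 + f 1 + f 2 + f 3"
  unfolding UNIV_4_from_0 by (simp add: add.assoc)

lemma all_4_iff: "(\<forall>i::4. P i) \<longleftrightarrow> P 0 \<and> P 1 \<and> P 2 \<and> P 3"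
  using UNIV_4_from_0 by (metis UNIV_I insertE singletonD)

text \<open>Appending \<open>v\<close> to \<open>u\<close> sends the value to
  \<open>num u * 5 ^ length v + num v\<close>. Row 2 carries the two values and the diagonal the two
  powers, which makes the encoding multiplicative. The last corner is 1 here and 0 in
  \<open>target\<close>, which tells them apart.\<close>

definition tile_mat :: "nat list \<times> nat list \<Rightarrow> int ^ 4 ^ 4" where
  "tile_mat = (\<lambda>(u, v). \<chi> i j.
     if i = 0 \<and> j = 0 then 5 ^ length v
     else if i = 1 \<and> j = 1 then 5 ^ length u
     else if i = 2 \<and> j = 0 then num v
     else if i = 2 \<and> j = 1 then num u
     else if i = 2 \<and> j = 2 \<or> i = 3 \<and> j = 3 then 1
     else 0)"

section \<open>The rank-one matrix and its factorizations\<close>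

definition outer :: "'a::comm_semiring_1 ^ 'n \<Rightarrow> 'a ^ 'n \<Rightarrow> 'a ^ 'n ^ 'n" where
  "outer a b = (\<chi> i j. a $ i * b $ j)"

definition probe :: "int ^ 4" where
  "probe = (\<chi> i. if i = 0 then 3 else if i = 1 then -3 else if i = 2 then 1 else 0)"

definition word_vec :: "nat list \<Rightarrow> int ^ 4" where
  "word_vec w = (\<chi> i. if i = 0 then num w else if i = 2 then 1 else 0)"

definition target :: "nat list \<Rightarrow> int ^ 4 ^ 4" where
  "target w = outer probe (word_vec w)"

lemma tile_mat_mult: "tile_mat (u, v) ** tile_mat (u', v') = tile_mat (u @ u', v @ v')"
  by (simp add: vec_eq_iff all_4_iff matrix_matrix_mult_def tile_mat_def sum_UNIV_4
      num_append power_add)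

lemma tile_mat_Nil: "tile_mat ([], []) = mat 1"
  by (simp add: vec_eq_iff all_4_iff tile_mat_def mat_def)

lemma mat_prod_Nil: "mat_prod [] = mat 1"
  by (simp add: mat_prod_def)

lemma mat_prod_Cons: "mat_prod (A # As) = A ** mat_prod As"
  by (simp add: mat_prod_def)

lemma mat_prod_append: "mat_prod (As @ Bs) = mat_prod As ** mat_prod Bs"
  by (induction As) (simp_all add: mat_prod_Nil mat_prod_Cons matrix_mul_assoc)

lemma mat_prod_tiles:
  "mat_prod (map tile_mat ts) = tile_mat (concat (map fst ts), concat (map snd ts))"
  by (induction ts) (auto simp: mat_prod_Nil mat_prod_Cons tile_mat_Nil tile_mat_mult)

lemma outer_mult: "outer a b ** A = outer a (b v* A)"
  by (simp add: outer_def vec_eq_iff matrix_matrix_mult_def vector_matrix_mult_def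
      sum_distrib_left algebra_simps)

lemma mult_outer: "A ** outer a b = outer (A *v a) b"
  by (simp add: outer_def vec_eq_iff matrix_matrix_mult_def matrix_vector_mult_def
      sum_distrib_left sum_distrib_right mult_ac)

lemma vector_mult_outer: "c v* outer a b = (\<chi> j. (\<Sum>i\<in>UNIV. c $ i * a $ i) * b $ j)"
  by (simp add: outer_def vec_eq_iff vector_matrix_mult_def sum_distrib_left sum_distrib_right mult_ac)

lemma vector_matrix_mult_assoc: "(x v* A) v* B = x v* (A ** B)"
  for x :: "'a::comm_semiring_1 ^ 'n"
proof -
  have "(\<Sum>i\<in>UNIV. (\<Sum>k\<in>UNIV. A $ k $ i * x $ k) * B $ i $ j) =
      (\<Sum>k\<in>UNIV. (\<Sum>i\<in>UNIV. A $ k $ i * B $ i $ j) * x $ k)" for j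
    unfolding sum_distrib_right by (subst sum.swap) (simp add: mult_ac)
  then show ?thesis
    by (simp add: vec_eq_iff vector_matrix_mult_def matrix_matrix_mult_def mult.commute)
qed

lemma tile_mat_probe:
  "tile_mat (u, v) *v probe = (\<chi> i. if i = 0 then 3 * 5 ^ length v else if i = 1 then - 3 * 5 ^ length u
     else if i = 2 then 3 * (num v - num u) + 1 else 0)"
  by (simp add: vec_eq_iff all_4_iff matrix_vector_mult_def tile_mat_def probe_def sum_UNIV_4)

lemma word_vec_tile_mat:
  "word_vec w v* tile_mat (u, v) = (\<chi> i. if i = 0 then num (w @ v) else if i = 1 then num u
     else if i = 2 then 1 else 0)"
  by (simp add: vec_eq_iff all_4_iff vector_matrix_mult_def tile_mat_def word_vec_def sum_UNIV_4
      num_append mult.commute)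

lemma word_vec_tile_mat_target:
  "word_vec w v* (tile_mat (u, v) ** (target w ** A)) =
    (\<chi> j. (3 * (num (w @ v) - num u) + 1) * (word_vec w v* A) $ j)"
  for A :: "int ^ 4 ^ 4"
proof -
  have "word_vec w v* (tile_mat (u, v) ** (target w ** A)) =
      (word_vec w v* tile_mat (u, v)) v* outer probe (word_vec w v* A)"
    by (simp add: target_def outer_mult vector_matrix_mult_assoc)
  then show ?thesis
    by (simp add: vector_mult_outer word_vec_tile_mat sum_UNIV_4 probe_def algebra_simps)
qed

text \<open>The factors are both 1 or both -1, and -1 is not congruent to 1 modulo 3.\<close>

lemma three_times_plus_one_unit:
  "(3 * k + 1) * l = 1 \<Longrightarrow> k = 0 \<and> l = 1" for k l :: int
  by (auto simp: zmult_eq_1_iff) presburger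

lemma target_not_tile: "target w \<noteq> tile_mat x"
proof -
  have "target w $ 3 $ 3 \<noteq> tile_mat x $ 3 $ 3"
    by (cases x) (simp add: target_def outer_def probe_def tile_mat_def)
  then show ?thesis by metis
qed

lemma subset_image_eq_map:
  "set xs \<subseteq> f ` A \<Longrightarrow> \<exists>ys. xs = map f ys \<and> set ys \<subseteq> A"
proof -
  assume "set xs \<subseteq> f ` A"
  then have "xs \<in> map f ` lists A" by (auto simp flip: lists_image)
  then show ?thesis by auto
qed

text \<open>For the direction to solvability, a factorization other than \<open>[target w]\<close>
  is cut at its first two occurrences of \<open>target w\<close>. Nothing can precede the first, and
  the tiles between the two solve the equation.\<close>

theorem more_than_one_factorization_iff_solvable:
  assumes letters: "\<And>u v. (u, v) \<in> X \<Longrightarrow> set u \<subseteq> {1..4} \<and> set v \<subseteq> {1..4} \<and> u \<noteq> []"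
    and w: "set w \<subseteq> {1..4}" "w \<noteq> []"
  shows "more_than_one_factorization (insert (target w) (tile_mat ` X)) (target w) \<longleftrightarrow> solvable X w"
proof
  let ?G = "insert (target w) (tile_mat ` X)" and ?B = "target w"
  assume "solvable X w"
  then obtain ts where ts: "set ts \<subseteq> X" "w @ concat (map snd ts) = concat (map fst ts)"
    unfolding solvable_def by blast
  have single: "factorization ?G ?B [?B]"
    by (simp add: factorization_def mat_prod_def)
  have "mat_prod (?B # map tile_mat ts @ [?B]) =
      outer probe (word_vec w v* (mat_prod (map tile_mat ts) ** (?B ** mat 1)))"
    by (simp add: mat_prod_Cons mat_prod_append mat_prod_Nil target_def outer_mult)
  also have "\<dots> = ?B"
    unfolding mat_prod_tiles word_vec_tile_mat_target
    using ts(2) by (simp add: target_def vec_eq_iff outer_def)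
  finally have "factorization ?G ?B (?B # map tile_mat ts @ [?B])"
    using ts(1) by (auto simp: factorization_def)
  moreover have "[?B] \<noteq> ?B # map tile_mat ts @ [?B]" by simp
  ultimately show "more_than_one_factorization ?G ?B"
    unfolding more_than_one_factorization_def using single by blast
next
  let ?G = "insert (target w) (tile_mat ` X)" and ?B = "target w"
  let ?U = "\<lambda>ts. concat (map fst ts)" and ?V = "\<lambda>ts. concat (map snd ts)"
  have words: "set (?U ts) \<subseteq> {1..4} \<and> set (?V ts) \<subseteq> {1..4}" if "set ts \<subseteq> X" for ts
    using that letters by fastforce
  have U_Nil: "ts = []" if "?U ts = []" "set ts \<subseteq> X" for ts
    using that letters by (cases ts) auto
  have tiles: "\<exists>ts. As = map tile_mat ts \<and> set ts \<subseteq> X" if "set As \<subseteq> ?G" "?B \<notin> set As" for As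
    using that by (intro subset_image_eq_map) auto
  assume "more_than_one_factorization ?G ?B"
  then obtain As where As: "factorization ?G ?B As" "As \<noteq> [?B]"
    unfolding more_than_one_factorization_def by metis
  have "?B \<in> set As"
  proof (rule ccontr)
    assume "?B \<notin> set As"
    then show False
      using tiles[of As] As(1) target_not_tile mat_prod_tiles unfolding factorization_def by metis
  qed
  then obtain Ps Rs where split: "As = Ps @ ?B # Rs" "?B \<notin> set Ps"
    by (meson split_list_first)
  then obtain ts where ts: "Ps = map tile_mat ts" "set ts \<subseteq> X"
    using tiles[of Ps] As(1) unfolding factorization_def by auto
  define c where "c = word_vec w v* mat_prod Rs"
  have "outer (tile_mat (?U ts, ?V ts) *v probe) c = ?B"
    using As(1) unfolding factorization_def split ts
    by (simp add: mat_prod_append mat_prod_Cons mat_prod_tiles target_def outer_mult mult_outer c_def)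
  then have entry: "(tile_mat (?U ts, ?V ts) *v probe) $ i * c $ j = probe $ i * word_vec w $ j" for i j
    by (simp only: target_def outer_def vec_eq_iff vec_lambda_beta)
  \<comment> \<open>Entry (2, 2) of \<open>target w\<close> is 1, so the scalar contributed by the
    prefix is a unit.\<close>
  have "(3 * (num (?V ts) - num (?U ts)) + 1) * c $ 2 = 1"
    using entry[of 2 2] unfolding tile_mat_probe by (simp add: probe_def word_vec_def)
  then have 1: "num (?V ts) - num (?U ts) = 0" "c $ 2 = 1"
    using three_times_plus_one_unit by blast+
  \<comment> \<open>Entry (1, 2) exposes the length of the first word of the prefix, now that
    \<open>c $ 2 = 1\<close>.\<close>
  have "(5::int) ^ length (?U ts) = 1"
    using entry[of 1 2] 1 unfolding tile_mat_probe by (simp add: probe_def word_vec_def)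
  then have "length (?U ts) = 0"
    using one_less_power[of "5::int" "length (?U ts)"] by fastforce
  then have "ts = []" using U_Nil[OF _ ts(2)] by blast
  then have "c = word_vec w"
    using entry[of 2] 1 unfolding tile_mat_probe by (simp add: probe_def vec_eq_iff)
  have "Rs \<noteq> []" using As(2) split ts \<open>ts = []\<close> by simp
  have Rs: "set Rs \<subseteq> ?G" using As(1) split unfolding factorization_def by simp
  \<comment> \<open>Otherwise the nonempty tail \<open>Rs\<close> would be a tile product fixing
    \<open>word_vec w\<close>; its coordinate 1 then gives the concatenated first words the value 0,
    though they are nonempty.\<close>
  have "?B \<in> set Rs"
  proof (rule ccontr)
    assume "?B \<notin> set Rs"
    then obtain ts' where ts': "Rs = map tile_mat ts'" "set ts' \<subseteq> X" using tiles Rs by blast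
    then have "num (?U ts') = 0"
      using \<open>c = word_vec w\<close> unfolding c_def ts' mat_prod_tiles word_vec_tile_mat
      by (simp add: vec_eq_iff all_4_iff word_vec_def)
    then have "?U ts' = []" using num_inject[of "?U ts'" "[]"] words ts'(2) by simp
    then show False using U_Nil ts' \<open>Rs \<noteq> []\<close> by simp
  qed
  then obtain Ps' Rs' where split': "Rs = Ps' @ ?B # Rs'" "?B \<notin> set Ps'"
    by (meson split_list_first)
  then obtain ts' where ts': "Ps' = map tile_mat ts'" "set ts' \<subseteq> X"
    using tiles[of Ps'] Rs by auto
  have "(3 * (num (w @ ?V ts') - num (?U ts')) + 1) * (word_vec w v* mat_prod Rs') $ 2 = 1"
    using \<open>c = word_vec w\<close>
    unfolding c_def split' ts' mat_prod_append mat_prod_Cons mat_prod_tiles word_vec_tile_mat_target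
    by (simp add: vec_eq_iff all_4_iff word_vec_def)
  then have "num (w @ ?V ts') = num (?U ts')"
    using three_times_plus_one_unit by fastforce
  then have "w @ ?V ts' = ?U ts'"
    using words[OF ts'(2)] w(1) by (intro num_inject) auto
  then show "solvable X w" unfolding solvable_def using ts'(2) by blast
qed

text \<open>The explicit list makes the code visibly computable from \<open>x\<close>. A natural
  number \<open>m\<close> is coded as \<open>2 * m\<close>, and \<open>-m\<close> as
  \<open>2 * m - 1\<close> for positive \<open>m\<close>.\<close>

lemma mat_code_target:
  assumes "num w = int x" "x > 0"
  shows "mat_code (target w) = list_encode
    [6 * x, 0, 6, 0, 6 * x - 1, 0, 5, 0, 2 * x, 0, 2, 0, 0, 0, 0, 0]"
proof -
  have "int_encode (- (3 * int x)) = 6 * x - 1"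
    using assms(2) by (simp add: int_encode_def sum_encode_def nat_diff_distrib nat_mult_distrib)
  moreover have "int_encode (int n) = 2 * n" for n
    by (simp add: int_encode_def sum_encode_def)
  from this[of "3 * x"] this[of x] this[of 0] this[of 1] this[of 3]
  have "int_encode (3 * int x) = 6 * x" "int_encode (int x) = 2 * x" "int_encode 0 = 0"
    "int_encode 1 = 2" "int_encode 3 = 6" by simp_all
  moreover have "int_encode (-3) = 5"
    by (simp add: int_encode_def sum_encode_def)
  ultimately show ?thesis
    by (simp add: mat_code_def target_def outer_def probe_def word_vec_def assms(1) mult.commute
        del: list_encode.simps)
qed

section \<open>Diagonalization\<close>

definition start_word :: "nat \<Rightarrow> nat list" where
  "start_word n = 3 # replicate (Suc (2 ^ n)) 4"

lemma num_start_word: "num (start_word n) = int (4 * 5 ^ Suc (2 ^ n) - 1)"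
proof -
  have "num (replicate m 4) = 5 ^ m - 1" for m
  proof (induction m)
    case (Suc m)
    have "num (replicate (Suc m) 4) = 5 * num (replicate m 4) + 4"
      using num_snoc[of "replicate m 4" 4] by (simp add: replicate_append_same)
    then show ?case using Suc by simp
  qed simp
  then have "num (start_word n) = 4 * 5 ^ Suc (2 ^ n) - 1"
    using num_append[of "[3]" "replicate (Suc (2 ^ n)) 4"]
    by (simp add: start_word_def num_def[of "[3]"] del: replicate.simps)
  then show ?thesis by (simp add: of_nat_diff)
qed

text \<open>This composes the reductions. The run on \<open>n\<close> starts at
  \<open>t * 2 ^ n + a\<close>, which is why \<open>start_word n\<close> carries
  \<open>2 ^ n\<close> in unary. The set \<open>X\<close> is chosen before \<open>n\<close>.\<close>

lemma rec_eval_halts_iff_solvable: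
  "\<exists>X. finite X \<and> (\<forall>(u, v) \<in> X. set u \<subseteq> {1..4} \<and> set v \<subseteq> {1..4} \<and> u \<noteq> []) \<and>
    (\<forall>n. solvable X (start_word n) \<longleftrightarrow> (\<exists>y. rec_eval D [n] y))"
proof -
  define c where "c = compile D [0] 1"
  let ?s = "\<lambda>n. (\<lambda>_. 0)(0 := n) :: store"
  obtain Rs t a where Rs: "finite Rs" "\<forall>(d, r, c, e) \<in> Rs. d > 0"
    and halt: "\<And>n. (t * 2 ^ n + a, 0) \<in> (affine_step Rs)\<^sup>* \<longleftrightarrow>
      (\<exists>u. (([c], ?s n), ([], u)) \<in> (machine_step (transitions c []))\<^sup>*)"
    using machine_halting_iff_affine_reach[OF finite_transitions, of "[c]" "[]" c "[]"] by blast
  obtain rl where rl: "set rl = Rs" using finite_list[OF Rs(1)] by blast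
  interpret affine_tiles rl t a
    by unfold_locales (use Rs(2) rl in auto)
  have "(\<exists>u. (?s n, u) \<in> sem c) \<longleftrightarrow> (\<exists>y. rec_eval D [n] y)" for n
  proof -
    have "(?s n, u) \<in> sem c \<longleftrightarrow> (\<exists>y. rec_eval D [n] y \<and> u = (?s n)(1 := y))" for u
      using compilesD[OF compiles, of "[0]" 1 "?s n" u D] by (simp add: c_def)
    then show ?thesis by blast
  qed
  then have "solvable tiles (start_word n) \<longleftrightarrow> (\<exists>y. rec_eval D [n] y)" for n
    unfolding start_word_def solvable_tiles_iff rl halt sem_iff_machine_steps[symmetric] .
  then show ?thesis
    using finite_tiles tile_letters fst_tile_not_Nil by (intro exI[of _ tiles]) blast
qed

definition target_code :: "nat \<Rightarrow> nat" where
  "target_code n = mat_code (target (start_word n))"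

lemma recursive1_target_code: "recursive1 target_code"
proof -
  define x where "x = (\<lambda>n::nat. 4 * 5 ^ Suc (2 ^ n) - 1 :: nat)"
  have x: "recursive1 x"
    unfolding x_def by (intro recursive1_arith recursive1_const recursive1_id)
  define hs where "hs = [\<lambda>n. 6 * x n, \<lambda>n. 0, \<lambda>n. 6, \<lambda>n. 0, \<lambda>n. 6 * x n - 1, \<lambda>n. 0, \<lambda>n. 5, \<lambda>n. 0,
    \<lambda>n. 2 * x n, \<lambda>n. 0, \<lambda>n. 2, \<lambda>n. 0, \<lambda>n. 0, \<lambda>n. 0, \<lambda>n. 0, \<lambda>n. 0]"
  have "\<forall>h \<in> set hs. recursive1 h"
    unfolding hs_def by (simp add: recursive1_arith recursive1_const x del: One_nat_def)
  then have "recursive1 (\<lambda>n. list_encode (map (\<lambda>h. h n) hs))"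
    by (rule recursive1_list_encode)
  moreover have "x n > 0" for n
  proof -
    have "(5::nat) ^ Suc (2 ^ n) > 0" by simp
    then show ?thesis unfolding x_def by linarith
  qed
  then have "target_code = (\<lambda>n. list_encode (map (\<lambda>h. h n) hs))"
    unfolding target_code_def hs_def using mat_code_target[of "start_word _" "x _"] num_start_word
    by (simp add: x_def fun_eq_iff del: list_encode.simps)
  ultimately show ?thesis by simp
qed

theorem theorem5:
  "\<not> decidable_on instance_code
      {(G :: (int ^ 4 ^ 4) set, M :: int ^ 4 ^ 4). finite G \<and> M \<in> generated_semigroup G}
      (\<lambda>(G, M). more_than_one_factorization G M)"
proof
  assume "decidable_on instance_code
      {(G :: (int ^ 4 ^ 4) set, M :: int ^ 4 ^ 4). finite G \<and> M \<in> generated_semigroup G}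
      (\<lambda>(G, M). more_than_one_factorization G M)"
  then obtain f where "\<forall>x \<in> {(G :: (int ^ 4 ^ 4) set, M). finite G \<and> M \<in> generated_semigroup G}.
      rec_eval f [instance_code x] (if case x of (G, M) \<Rightarrow> more_than_one_factorization G M then 1 else 0)"
    unfolding decidable_on_def by blast
  from bspec[OF this] have f: "rec_eval f [instance_code (G, M)]
      (if more_than_one_factorization G M then 1 else 0)"
    if "finite G" "M \<in> generated_semigroup G" for G and M :: "int ^ 4 ^ 4"
    using that by fastforce
  define code where "code = (\<lambda>n. prod_encode (n + 2 ^ target_code n, target_code n))"
  have "recursive1 code"
    unfolding code_def
    by (intro recursive1_prod_encode recursive1_arith recursive1_const recursive1_id
        recursive1_target_code)
  then obtain h where h: "\<And>n. rec_eval h [n] (code n)" unfolding recursive1_def by blast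
  \<comment> \<open>\<open>E\<close> ignores the search variable, so \<open>Minim E\<close> stops at
    once if the answer is 0 and searches forever if it is 1.\<close>
  define E where "E = Comp f [Comp h [Proj (Suc 0)]]"
  have E: "rec_eval E [m, n] y" if "rec_eval f [code n] y" for m n y
    unfolding E_def using that by (intro rec_eval_Comp1[OF rec_eval_Comp1[OF rec_eval_Proj1 h]])
  from rec_eval_halts_iff_solvable[of "Minim E"] obtain X where
    X: "finite X" "\<forall>(u, v) \<in> X. set u \<subseteq> {1..4} \<and> set v \<subseteq> {1..4} \<and> u \<noteq> []"
    and halts: "\<forall>n. solvable X (start_word n) \<longleftrightarrow> (\<exists>y. rec_eval (Minim E) [n] y)"
    by (elim exE conjE)
  \<comment> \<open>The self-reference: \<open>X\<close> was built from \<open>Minim E\<close>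
    alone, so its set code is available as an input.\<close>
  define n where "n = set_encode (mat_code ` tile_mat ` X)"
  define M where "M = target (start_word n)"
  define G where "G = insert M (tile_mat ` X)"
  \<comment> \<open>A new element adds exactly its own power of two to the set code.\<close>
  have "mat_code M \<notin> mat_code ` tile_mat ` X"
    using target_not_tile inj_mat_code unfolding M_def by (auto dest: injD)
  then have "set_encode (insert (mat_code M) (mat_code ` tile_mat ` X)) = 2 ^ mat_code M + n"
    unfolding n_def using X(1) by (intro set_encode_insert) auto
  then have "instance_code (G, M) = code n"
    by (simp add: instance_code_def code_def G_def target_code_def M_def[symmetric] add.commute)
  moreover have "M \<in> generated_semigroup G"
    unfolding generated_semigroup_def G_def
    by (rule CollectI, rule exI[of _ "[M]"]) (simp add: mat_prod_def)
  ultimately have f_n: "rec_eval f [code n] (if more_than_one_factorization G M then 1 else 0)"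
    using f[of G M] X(1) by (metis G_def finite_imageI finite_insert)
  have "more_than_one_factorization G M \<longleftrightarrow> solvable X (start_word n)"
    unfolding G_def M_def using X(2)
    by (intro more_than_one_factorization_iff_solvable) (auto simp: start_word_def)
  also have "\<dots> \<longleftrightarrow> (\<exists>y. rec_eval (Minim E) [n] y)" by (rule spec[OF halts])
  also have "\<dots> \<longleftrightarrow> \<not> more_than_one_factorization G M"
  proof
    assume "\<exists>y. rec_eval (Minim E) [n] y"
    then obtain y where y: "rec_eval E [y, n] 0" unfolding rec_eval_Minim_iff by blast
    show "\<not> more_than_one_factorization G M"
      using rec_eval_deterministic[OF E[OF f_n, of y] y] by (auto split: if_splits)
  next
    assume "\<not> more_than_one_factorization G M"
    then show "\<exists>y. rec_eval (Minim E) [n] y"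
      using E[OF f_n, of 0] unfolding rec_eval_Minim_iff by (intro exI[of _ 0]) simp
  qed
  finally show False by blast
qed

end
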